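(* Suppose $S$ is a discrete subset of $\mathbb{R}^2$ with $\mathrm{He}(S) < \infty$. If $m \geq 3$, then $$\mathrm{Tv}(S,m) = \mathrm{He}(S)(m-1) + 1.$$ Regarding the case $m = 2$, if $\mathrm{He}(S) \leq 3$, then $$\mathrm{Tv}(S,2) = \mathrm{He}(S) + 1,$$ and if $\mathrm{He}(S) \geq 4$, then $$\mathrm{He}(S) + 1 \leq \mathrm{Tv}(S,2) \leq \mathrm{He}(S) + 2,$$ and both values are possible.
   Context: For $S\subseteq\mathbb{R}^d$ and an integer $m\geq 2$, the Tverberg number $\mathrm{Tv}(S,m)$ is the smallest positive integer $n$ such that any multiset of $n$ points in $S$ admits a partition into $m$ submultisets $A_1,\dots,A_m$ with $\left(\bigcap_{i=1}^m\mathrm{conv}(A_i)\right)\cap S\neq\varnothing$ (and $\mathrm{Tv}(S,m)=\infty$ if no such number exists). The Helly number $\mathrm{He}(S)$ is the smallest positive integer $h$ such that whenever $\mathcal{F}$ is a finite family of convex sets in $\mathbb{R}^d$ such that every subfamily of at most $h$ members has intersection meeting $S$, then $\bigcap\mathcal{F}$ meets $S$ (and $\mathrm{He}(S)=\infty$ if no such integer exists). *)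

theory Defs
  imports "HOL-Analysis.Analysis" "HOL-Library.Multiset" "HOL-Library.Extended_Nat"
begin

type_synonym pt = "real ^ 2"

definition discrete_set :: "pt set \<Rightarrow> bool" where
  "discrete_set S \<longleftrightarrow> (\<forall>B. bounded B \<longrightarrow> finite (B \<inter> S))"

definition tverberg_partitionable :: "pt set \<Rightarrow> nat \<Rightarrow> pt multiset \<Rightarrow> bool" where
  "tverberg_partitionable S m M \<longleftrightarrow>
     (\<exists>A :: nat \<Rightarrow> pt multiset. (\<Sum>i<m. A i) = M \<and>
        (\<Inter>i<m. convex hull (set_mset (A i))) \<inter> S \<noteq> {})"

definition tv_prop :: "pt set \<Rightarrow> nat \<Rightarrow> nat \<Rightarrow> bool" where
  "tv_prop S m n \<longleftrightarrow>
     (\<forall>M :: pt multiset. size M = n \<longrightarrow> set_mset M \<subseteq> S \<longrightarrow> tverberg_partitionable S m M)"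

definition Tv :: "pt set \<Rightarrow> nat \<Rightarrow> enat" where
  "Tv S m = (if \<exists>n>0. tv_prop S m n then enat (LEAST n. n > 0 \<and> tv_prop S m n) else \<infinity>)"

definition helly_prop :: "pt set \<Rightarrow> nat \<Rightarrow> bool" where
  "helly_prop S h \<longleftrightarrow>
     (\<forall>F :: pt set set. finite F \<longrightarrow> (\<forall>K\<in>F. convex K) \<longrightarrow>
        (\<forall>G\<subseteq>F. card G \<le> h \<longrightarrow> \<Inter>G \<inter> S \<noteq> {}) \<longrightarrow> \<Inter>F \<inter> S \<noteq> {})"

definition He :: "pt set \<Rightarrow> enat" where
  "He S = (if \<exists>h>0. helly_prop S h then enat (LEAST h. h > 0 \<and> helly_prop S h) else \<infinity>)"

end

theory Submission
  imports Defs
begin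

text \<open>
  Let \<open>h\<close> be the Helly number of \<open>S\<close>.

  Lower bound: a minimal family violating the Helly property for \<open>h - 1\<close> yields a set \<open>X \<subseteq> S\<close> with at
  least \<open>h\<close> points such that the hulls of the sets \<open>X - {x}\<close> have no common point in \<open>S\<close>; taking every
  point of \<open>X\<close> with multiplicity \<open>m - 1\<close> gives a multiset without a partition.

  Upper bound for \<open>h \<ge> 4\<close>: the Helly property gives a point \<open>p \<in> S\<close> all of whose closed half-planes
  contain at least \<open>m\<close> of the points. If there are more than \<open>3 m\<close> points, one of them can be removed
  without destroying this, since otherwise three half-planes with only \<open>m\<close> points each would cover all
  points. Once there are exactly \<open>3 m\<close> points, sorted by angle around \<open>p\<close>, the triangles formed by the
  points number \<open>i\<close>, \<open>i + m\<close>, \<open>i + 2 m\<close> contain \<open>p\<close> (Birch's argument).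

  Upper bound for \<open>h \<le> 3\<close>: \<open>S\<close> has affine dimension at most \<open>h - 1\<close>, so Tverberg's theorem in the affine
  hull of \<open>S\<close> yields a partition whose hulls have a common point. An extreme point of the intersection
  of the hulls is a point of \<open>S\<close> or a crossing of two segments spanned by \<open>S\<close>, and the Helly property
  for \<open>3\<close> forces such a crossing into \<open>S\<close>.
\<close>

section \<open>Multisets and finite sets\<close>

lemma ex_submset:
  assumes "n \<le> size M"
  obtains N where "N \<subseteq># M" "size N = n"
proof -
  have "\<exists>N. N \<subseteq># M \<and> size N = n"
  proof -
    obtain xs where xs: "mset xs = M" using ex_mset by blast
    have "mset (take n xs) \<subseteq># mset (take n xs) + mset (drop n xs)" by simp
    also have "\<dots> = M" unfolding xs[symmetric] mset_append[symmetric] by simp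
    finally show ?thesis using assms xs by (intro exI[of _ "mset (take n xs)"]) auto
  qed
  then show ?thesis using that by blast
qed

lemma finite_submsets: "finite {N. N \<subseteq># M}"
proof (induction M)
  case (add x M)
  have "{N. N \<subseteq># add_mset x M} \<subseteq> {N. N \<subseteq># M} \<union> add_mset x ` {N. N \<subseteq># M}"
  proof
    fix N assume N: "N \<in> {N. N \<subseteq># add_mset x M}"
    show "N \<in> {N. N \<subseteq># M} \<union> add_mset x ` {N. N \<subseteq># M}"
    proof (cases "x \<in># N")
      case True
      then obtain N' where "N = add_mset x N'" by (metis mset_add)
      then show ?thesis using N by auto
    next
      case False
      then have "N \<subseteq># M"
        using N by (metis Diff_eq_empty_iff_mset add_mset_remove_trivial diff_diff_add_mset
            diff_single_trivial mem_Collect_eq add_mset_add_single subset_eq_diff_conv)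
      then show ?thesis by simp
    qed
  qed
  then show ?case using add by (meson finite_UnI finite_imageI finite_subset)
qed auto

text \<open>The points left over go into part 0, which exists as \<open>0 < m\<close>. Leaving the
  indices from \<open>m\<close> on untouched keeps an empty tail empty, as
  \<open>proper_partition\<close> demands.\<close>

lemma extend_to_partition:
  fixes A :: "nat \<Rightarrow> 'a multiset"
  assumes "0 < m" "(\<Sum>i<m. A i) \<subseteq># M"
  obtains B where "(\<Sum>i<m. B i) = M" "\<And>i. A i \<subseteq># B i" "\<And>i. m \<le> i \<Longrightarrow> B i = A i"
proof
  define B where "B = A(0 := A 0 + (M - (\<Sum>i<m. A i)))"
  have "(\<Sum>i<m. B i) = B 0 + (\<Sum>i\<in>{..<m} - {0}. B i)"
    using assms(1) by (subst sum.remove[of _ 0]) auto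
  also have "\<dots> = (M - (\<Sum>i<m. A i)) + (A 0 + (\<Sum>i\<in>{..<m} - {0}. A i))"
    by (simp add: B_def)
  also have "A 0 + (\<Sum>i\<in>{..<m} - {0}. A i) = (\<Sum>i<m. A i)"
    using assms(1) by (subst (2) sum.remove[of _ 0]) auto
  finally show "(\<Sum>i<m. B i) = M"
    using assms(2) by simp
  show "A i \<subseteq># B i" for i by (simp add: B_def)
  show "B i = A i" if "m \<le> i" for i using that assms(1) by (simp add: B_def)
qed

lemma sum_lessThan_add:
  fixes f :: "nat \<Rightarrow> 'a :: comm_monoid_add"
  shows "(\<Sum>i<a + b. f i) = (\<Sum>i<a. f i) + (\<Sum>i<b. f (a + i))"
  by (induction b) (simp_all add: add.assoc)

lemma sum_nth_mset: "(\<Sum>i<length xs. {#xs ! i#}) = mset xs"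
  by (induction xs rule: rev_induct) (simp_all add: nth_append)

lemma subset_singleton_of_card_le_1:
  assumes "finite T" "card T \<le> 1" "T \<subseteq> U" "a \<in> U"
  shows "\<exists>v\<in>U. T \<subseteq> {v}"
proof (cases "T = {}")
  case False
  then have "card T = 1" using assms(1,2) by (simp add: le_Suc_eq)
  then obtain v where "T = {v}" by (rule card_1_singletonE)
  then show ?thesis using assms(3) by blast
qed (use assms(4) in blast)

lemma ex_common_lower_bound:
  assumes "finite I" "\<And>i. i \<in> I \<Longrightarrow> 0 < (e i :: real)"
  obtains d where "0 < d" "\<And>i. i \<in> I \<Longrightarrow> d \<le> e i"
proof
  show "0 < Min (insert 1 (e ` I))" using assms by (subst Min_gr_iff) auto
  show "Min (insert 1 (e ` I)) \<le> e i" if "i \<in> I" for i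
    using assms(1) that by (intro Min_le) auto
qed

section \<open>Helly and Tverberg numbers\<close>

lemma helly_prop_mono:
  assumes "helly_prop S h" "h \<le> k"
  shows "helly_prop S k"
  using assms unfolding helly_prop_def by (meson le_trans)

text \<open>\<open>helly_prop\<close> speaks of sets of sets, where coinciding members count once.
  Choosing the indices \<open>J\<close> so that \<open>C\<close> is injective on them makes the
  cardinalities agree.\<close>

lemma helly_prop_family:
  assumes "helly_prop S h" "finite I" "\<And>i. i \<in> I \<Longrightarrow> convex (C i)"
    and meet: "\<And>J. \<lbrakk>J \<subseteq> I; card J \<le> h\<rbrakk> \<Longrightarrow> (\<Inter>i\<in>J. C i) \<inter> S \<noteq> {}"
  shows "(\<Inter>i\<in>I. C i) \<inter> S \<noteq> {}"
proof -
  have "\<Inter>G \<inter> S \<noteq> {}" if "G \<subseteq> C ` I" "card G \<le> h" for G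
  proof -
    obtain J where "J \<subseteq> I" "inj_on C J" "G = C ` J"
      using \<open>G \<subseteq> C ` I\<close> by (metis subset_image_inj)
    then show ?thesis
      using meet[of J] that(2) by (simp add: card_image)
  qed
  then show ?thesis
    using assms(1)[unfolded helly_prop_def, rule_format, of "C ` I"] assms(2,3) by blast
qed

text \<open>In a subfamily \<open>G\<close> minimal among those whose intersection misses
  \<open>S\<close>, every \<open>K\<close> has a point \<open>x K\<close> of \<open>S\<close> lying
  in all other members but not in \<open>K\<close>. These points are distinct, and \<open>K\<close>
  contains the hull of all of them except \<open>x K\<close>.\<close>

lemma not_helly_prop_witness:
  assumes "\<not> helly_prop S h"
  obtains X where "finite X" "X \<subseteq> S" "h < card X" "(\<Inter>x\<in>X. convex hull (X - {x})) \<inter> S = {}"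
proof -
  obtain F where F: "finite F" "\<forall>K\<in>F. convex K" "\<Inter>F \<inter> S = {}"
    and small: "\<And>G. \<lbrakk>G \<subseteq> F; card G \<le> h\<rbrakk> \<Longrightarrow> \<Inter>G \<inter> S \<noteq> {}"
    using assms unfolding helly_prop_def by auto
  obtain G where G: "G \<subseteq> F" "\<Inter>G \<inter> S = {}"
    and min: "\<And>G'. G' \<subset> G \<Longrightarrow> \<Inter>G' \<inter> S \<noteq> {}"
  proof -
    let ?\<G> = "{G. G \<subseteq> F \<and> \<Inter>G \<inter> S = {}}"
    have "finite ?\<G>" using F(1) by auto
    moreover have "F \<in> ?\<G>" using F by auto
    ultimately have "\<exists>G\<in>?\<G>. G \<subseteq> F \<and> (\<forall>G'\<in>?\<G>. G' \<subseteq> G \<longrightarrow> G = G')"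
      by (rule finite_has_minimal2)
    then obtain G where G: "G \<subseteq> F" "\<Inter>G \<inter> S = {}"
      and min: "\<And>G'. \<lbrakk>G' \<subseteq> F; \<Inter>G' \<inter> S = {}; G' \<subseteq> G\<rbrakk> \<Longrightarrow> G = G'"
      by auto
    show ?thesis
    proof (rule that[OF G])
      fix G' assume "G' \<subset> G"
      then show "\<Inter>G' \<inter> S \<noteq> {}" using min[of G'] G(1) by auto
    qed
  qed
  have "finite G" using G(1) F(1) finite_subset by auto
  have "\<forall>K\<in>G. \<exists>x. x \<in> \<Inter>(G - {K}) \<inter> S" using min by blast
  then obtain x where x: "\<And>K. K \<in> G \<Longrightarrow> x K \<in> \<Inter>(G - {K}) \<inter> S" by metis
  have notin: "x K \<notin> K" if "K \<in> G" for K
    using x[OF that] G(2) by blast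
  have inj: "inj_on x G"
  proof (rule inj_onI, rule ccontr)
    fix K L assume "K \<in> G" "L \<in> G" "x K = x L" "K \<noteq> L"
    then have "x L \<in> L" using x[of K] by auto
    then show False using notin[of L] \<open>L \<in> G\<close> by blast
  qed
  have hull: "convex hull (x ` G - {x K}) \<subseteq> K" if "K \<in> G" for K
    using that x F(2) G(1) by (intro hull_minimal) auto
  show ?thesis
  proof
    show "finite (x ` G)" "x ` G \<subseteq> S" using \<open>finite G\<close> x by auto
    show "h < card (x ` G)"
      unfolding card_image[OF inj] using small[OF G(1)] G(2) by (meson not_le)
    show "(\<Inter>y\<in>x ` G. convex hull (x ` G - {y})) \<inter> S = {}"
    proof (rule ccontr)
      assume "\<not> ?thesis"
      then obtain p where "p \<in> S" "\<And>K. K \<in> G \<Longrightarrow> p \<in> convex hull (x ` G - {x K})"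
        by auto
      then have "p \<in> \<Inter>G \<inter> S" using hull by blast
      then show False using G(2) by simp
    qed
  qed
qed

lemma not_helly_prop_0:
  assumes "S \<noteq> {}"
  shows "\<not> helly_prop S 0"
proof
  assume "helly_prop S 0"
  moreover have "\<Inter>G \<inter> S \<noteq> {}" if "G \<subseteq> {{}}" "card G \<le> 0" for G :: "pt set set"
    using that assms by (cases "G = {}") (auto dest: finite_subset)
  ultimately have "\<Inter>{{} :: pt set} \<inter> S \<noteq> {}"
    unfolding helly_prop_def by (elim allE[of _ "{{}}"]) auto
  then show False by simp
qed

text \<open>Leastness ranges over positive numbers only, so for \<open>h = 1\<close> the last claim
  is about 0 and needs \<open>S \<noteq> {}\<close>.\<close>

lemma He_enatD:
  assumes "He S = enat h" "S \<noteq> {}"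
  shows "0 < h" "helly_prop S h" "\<not> helly_prop S (h - 1)"
proof -
  let ?P = "\<lambda>h. 0 < h \<and> helly_prop S h"
  have ex: "\<exists>h. ?P h" and h: "h = (LEAST h. ?P h)"
    using assms(1) unfolding He_def by (auto split: if_splits)
  show "0 < h" "helly_prop S h"
    using LeastI_ex[OF ex] unfolding h by auto
  then have "\<not> ?P (h - 1)"
    unfolding h by (intro not_less_Least) auto
  then show "\<not> helly_prop S (h - 1)"
    using not_helly_prop_0[OF assms(2)] by (cases "h - 1") auto
qed

lemma He_le:
  assumes "helly_prop S h" "0 < h"
  shows "He S \<le> enat h"
  using assms unfolding He_def by (auto intro: Least_le)

section \<open>Tverberg partitions, multisets without one, and centerpoints\<close>

lemma tverberg_partitionableI:
  assumes "0 < m" "(\<Sum>i<m. A i) \<subseteq># M" "p \<in> S" "\<And>i. i < m \<Longrightarrow> p \<in> convex hull (set_mset (A i))"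
  shows "tverberg_partitionable S m M"
proof -
  obtain B where "(\<Sum>i<m. B i) = M" "\<And>i. A i \<subseteq># B i"
    using extend_to_partition[OF assms(1,2)] by blast
  moreover have "p \<in> convex hull (set_mset (B i))" if "i < m" for i
    using assms(4)[OF that] hull_mono[OF set_mset_mono[OF calculation(2)]] by blast
  ultimately show ?thesis
    unfolding tverberg_partitionable_def using assms(3) by blast
qed

lemma tv_prop_mono:
  assumes "tv_prop S m n" "n \<le> n'" "0 < m"
  shows "tv_prop S m n'"
  unfolding tv_prop_def
proof (intro allI impI)
  fix M :: "pt multiset"
  assume M: "size M = n'" "set_mset M \<subseteq> S"
  obtain N where N: "N \<subseteq># M" "size N = n"
    using M(1) assms(2) ex_submset by metis
  then have "tverberg_partitionable S m N"
    using assms(1) M(2) set_mset_mono[OF N(1)] unfolding tv_prop_def by auto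
  then show "tverberg_partitionable S m M"
    unfolding tverberg_partitionable_def[of S m N]
    using tverberg_partitionableI[OF assms(3), of _ M _ S] N(1) by blast
qed

lemma Tv_le:
  assumes "tv_prop S m n" "0 < n"
  shows "Tv S m \<le> enat n"
  using assms unfolding Tv_def by (auto intro: Least_le)

lemma Tv_ge:
  assumes "\<not> tv_prop S m n" "0 < m"
  shows "enat (n + 1) \<le> Tv S m"
proof -
  have "n + 1 \<le> k" if "tv_prop S m k" for k
    using assms tv_prop_mono[OF that, of n] by force
  then have "n + 1 \<le> (LEAST n. n > 0 \<and> tv_prop S m n)" if "\<exists>n>0. tv_prop S m n"
    using LeastI_ex[of "\<lambda>n. n > 0 \<and> tv_prop S m n"] that by blast
  then show ?thesis unfolding Tv_def by auto
qed

text \<open>A point of multiplicity \<open>m - 1\<close> is absent from one of the \<open>m\<close>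
  parts, so a common point of the hulls would lie in \<open>convex hull (X - {x})\<close> for every
  \<open>x\<close>.\<close>

lemma not_tv_prop:
  assumes X: "finite X" "X \<subseteq> S" "(\<Inter>x\<in>X. convex hull (X - {x})) \<inter> S = {}" and "0 < m"
  shows "\<not> tv_prop S m (card X * (m - 1))"
proof
  define M where "M = (\<Sum>x\<in>X. replicate_mset (m - 1) x)"
  have count: "count M x = (if x \<in> X then m - 1 else 0)" for x
    using X(1) by (simp add: M_def count_sum)
  have size: "size M = card X * (m - 1)"
    by (simp add: M_def size_multiset_sum)
  have set: "set_mset M \<subseteq> X"
    using count by (metis count_eq_zero_iff subsetI)
  assume "tv_prop S m (card X * (m - 1))"
  then have "tverberg_partitionable S m M"
    unfolding tv_prop_def using size set X(2) by blast
  then obtain A p where A: "(\<Sum>i<m. A i) = M"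
    and p: "p \<in> S" "\<And>i. i < m \<Longrightarrow> p \<in> convex hull (set_mset (A i))"
    unfolding tverberg_partitionable_def by blast
  have "p \<in> convex hull (X - {x})" if "x \<in> X" for x
  proof -
    have "\<exists>i<m. x \<notin># A i"
    proof (rule ccontr)
      assume "\<not> (\<exists>i<m. x \<notin># A i)"
      then have "(\<Sum>i<m. 1) \<le> (\<Sum>i<m. count (A i) x)"
        by (intro sum_mono) (auto simp: Suc_le_eq)
      also have "\<dots> = count M x"
        unfolding A[symmetric] by (simp add: count_sum)
      finally show False
        using count[of x] that assms(4) by auto
    qed
    then obtain i where i: "i < m" "x \<notin># A i" by blast
    have "A i \<subseteq># M"
      unfolding A[symmetric] using i(1) by (subst sum.remove[of _ i]) auto
    then have "set_mset (A i) \<subseteq> X - {x}"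
      using i(2) set set_mset_mono by fastforce
    then show ?thesis
      using p(2)[OF i(1)] hull_mono by blast
  qed
  then show False using X(3) p(1) by blast
qed

text \<open>The submultisets considered omit at most \<open>m - 1\<close> points each. Any
  \<open>h\<close> of them omit at most \<open>h * (m - 1)\<close> points together, so some point of
  \<open>M\<close> survives in all of them, and the Helly property applies to their hulls.\<close>

lemma helly_prop_common_hull_point:
  assumes "helly_prop S h" "h * (m - 1) < size M" "set_mset M \<subseteq> S"
  obtains p where "p \<in> S"
    "\<And>N. \<lbrakk>N \<subseteq># M; size M < size N + m\<rbrakk> \<Longrightarrow> p \<in> convex hull (set_mset N)"
proof -
  define I where "I = {N. N \<subseteq># M \<and> size M < size N + m}"
  have fin: "finite I"
    unfolding I_def by (rule finite_subset[OF _ finite_submsets[of M]]) auto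
  have "(\<Inter>N\<in>I. convex hull (set_mset N)) \<inter> S \<noteq> {}"
  proof (rule helly_prop_family[OF assms(1) fin])
    fix J assume J: "J \<subseteq> I" "card J \<le> h"
    have "finite J" using J(1) fin finite_subset by auto
    have "size (\<Sum>N\<in>J. M - N) = (\<Sum>N\<in>J. size (M - N))"
      by (simp add: size_multiset_sum)
    also have "\<dots> \<le> (\<Sum>N\<in>J. m - 1)"
      using J(1) by (intro sum_mono) (force simp: I_def size_Diff_submset)
    also have "\<dots> \<le> h * (m - 1)" using J(2) by simp
    finally have "\<not> M \<subseteq># (\<Sum>N\<in>J. M - N)"
      using assms(2) size_mset_mono by fastforce
    then obtain v where v: "count (\<Sum>N\<in>J. M - N) v < count M v"
      by (meson mset_subset_eqI not_le)
    have "v \<in># N" if "N \<in> J" for N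
    proof (rule ccontr)
      assume "v \<notin># N"
      then have "count M v = count (M - N) v"
        by (simp add: not_in_iff)
      also have "\<dots> \<le> count (\<Sum>N\<in>J. M - N) v"
        using member_le_sum[of N J "\<lambda>N. count (M - N) v"] \<open>finite J\<close> that
        by (simp add: count_sum)
      finally show False using v by simp
    qed
    moreover have "v \<in> S"
      using v assms(3) by (metis count_eq_zero_iff not_less_zero subsetD)
    ultimately show "(\<Inter>N\<in>J. convex hull (set_mset N)) \<inter> S \<noteq> {}"
      using hull_inc by (metis (mono_tags, lifting) INT_I IntI empty_iff)
  qed auto
  then show ?thesis using that unfolding I_def by blast
qed

text \<open>If a closed half-plane bounded by a line through \<open>p\<close> had fewer than
  \<open>m\<close> points, the remaining ones would have \<open>p\<close> in their hull, although
  they lie strictly on the other side.\<close>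

lemma helly_prop_centerpoint:
  assumes "helly_prop S h" "h * (m - 1) < size M" "set_mset M \<subseteq> S"
  obtains p where "p \<in> S" "\<And>u. m \<le> size {#x \<in># M. u \<bullet> (x - p) \<le> 0#}"
proof -
  obtain p where p: "p \<in> S"
    "\<And>N. \<lbrakk>N \<subseteq># M; size M < size N + m\<rbrakk> \<Longrightarrow> p \<in> convex hull (set_mset N)"
    using helly_prop_common_hull_point[OF assms] by blast
  have "m \<le> size {#x \<in># M. u \<bullet> (x - p) \<le> 0#}" for u
  proof (rule ccontr)
    assume less: "\<not> ?thesis"
    let ?N = "{#x \<in># M. \<not> u \<bullet> (x - p) \<le> 0#}"
    have "size {#x \<in># M. u \<bullet> (x - p) \<le> 0#} + size ?N = size M"
      by (metis multiset_partition size_union)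
    then have "p \<in> convex hull (set_mset ?N)"
      using less by (intro p(2)) auto
    also have "\<dots> \<subseteq> {x. u \<bullet> x > u \<bullet> p}"
      by (intro hull_minimal convex_halfspace_gt) (auto simp: inner_diff_right)
    finally show False by simp
  qed
  then show ?thesis using that p(1) by blast
qed

section \<open>Points of large half-plane depth\<close>

lemma inner_pt: "(u :: pt) \<bullet> v = u $ 1 * v $ 1 + u $ 2 * v $ 2"
  by (simp add: inner_vec_def sum_2)

text \<open>If 0 lies in the hull of the normals, Caratheodory's theorem selects three whose
  half-planes cover the plane. Otherwise all normals lie in an open half-plane
  \<open>v \<bullet> u > 0\<close>, and the two of extreme slope suffice.\<close>

lemma halfplane_cover_3:
  fixes U :: "pt set"
  assumes "finite U"
  obtains T where "T \<subseteq> U" "card T \<le> 3" "\<And>u z. \<lbrakk>u \<in> U; u \<bullet> z \<le> 0\<rbrakk> \<Longrightarrow> \<exists>t\<in>T. t \<bullet> z \<le> 0"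
proof (cases "0 \<in> convex hull U")
  case True
  then obtain T where T: "finite T" "T \<subseteq> U" "card T \<le> DIM(pt) + 1" "0 \<in> convex hull T"
    unfolding caratheodory[of U] by blast
  have "\<exists>t\<in>T. t \<bullet> z \<le> 0" for z
  proof (rule ccontr)
    assume "\<not> ?thesis"
    then have "convex hull T \<subseteq> {t. z \<bullet> t > 0}"
      by (intro hull_minimal convex_halfspace_gt) (auto simp: inner_commute not_le)
    then show False using T(4) by auto
  qed
  then show ?thesis using that[of T] T by auto
next
  case False
  show ?thesis
  proof (cases "U = {}")
    case True
    then show ?thesis using that[of "{}"] by auto
  next
    case nonempty: False
    have "closed (convex hull U)"
      using assms by (simp add: compact_imp_closed finite_imp_compact_convex_hull)
    then obtain v b where v: "v \<bullet> 0 < b" "\<forall>u\<in>convex hull U. v \<bullet> u > b"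
      using separating_hyperplane_closed_point[of "convex hull U" 0] False convex_convex_hull by metis
    have pos: "v \<bullet> u > 0" if "u \<in> U" for u
      using v hull_inc[OF that, of convex] by fastforce
    \<comment> \<open>\<open>w\<close> is \<open>v\<close> turned by a right angle and
      \<open>s u\<close> is the slope of \<open>u\<close> in the frame \<open>v\<close>,
      \<open>w\<close>. Up to a positive factor \<open>u \<bullet> z\<close> is affine in
      \<open>s u\<close>, so it is positive as soon as it is positive at both extreme
      slopes.\<close>
    define w :: pt where "w = vector [- v $ 2, v $ 1]"
    define s where "s u = (w \<bullet> u) / (v \<bullet> u)" for u
    have s: "(v \<bullet> v) * (u \<bullet> z) = (v \<bullet> u) * (v \<bullet> z + s u * (w \<bullet> z))" if "u \<in> U" for u z
      using pos[OF that] by (simp add: s_def distrib_left) (simp add: inner_pt w_def algebra_simps)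
    have "v \<bullet> v > 0" using pos nonempty by fastforce
    then have sign: "u \<bullet> z > 0 \<longleftrightarrow> v \<bullet> z + s u * (w \<bullet> z) > 0" if "u \<in> U" for u z
      using s[OF that, of z] pos[OF that] by (metis zero_less_mult_pos zero_less_mult_iff)
    obtain a where a: "a \<in> U" "\<And>u. u \<in> U \<Longrightarrow> s a \<le> s u"
      using ex_min_if_finite[of "s ` U"] assms nonempty by (fastforce simp: not_less)
    obtain b where b: "b \<in> U" "\<And>u. u \<in> U \<Longrightarrow> s u \<le> s b"
      using Max_ge[of "s ` U"] Max_in[of "s ` U"] assms nonempty by fastforce
    show ?thesis
    proof (rule that[of "{a, b}"])
      fix u z assume u: "u \<in> U" "u \<bullet> z \<le> 0"
      show "\<exists>t\<in>{a, b}. t \<bullet> z \<le> 0"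
      proof (rule ccontr)
        assume "\<not> ?thesis"
        then have ab: "v \<bullet> z + s a * (w \<bullet> z) > 0" "v \<bullet> z + s b * (w \<bullet> z) > 0"
          using sign[OF a(1), of z] sign[OF b(1), of z] by auto
        have "s a * (w \<bullet> z) \<le> s u * (w \<bullet> z) \<or> s b * (w \<bullet> z) \<le> s u * (w \<bullet> z)"
          using a(2)[OF u(1)] b(2)[OF u(1)]
          by (metis linorder_linear mult_right_mono mult_right_mono_neg)
        then have "u \<bullet> z > 0"
          unfolding sign[OF u(1)] using ab by linarith
        then show False using u(2) by simp
      qed
    qed (use a(1) b(1) in \<open>auto simp: card_insert_if\<close>)
  qed
qed

lemma size_le_sum_filter:
  assumes "finite T" "\<And>x. x \<in># X \<Longrightarrow> \<exists>t\<in>T. P t x"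
  shows "size X \<le> (\<Sum>t\<in>T. size (filter_mset (P t) X))"
proof -
  have "X \<subseteq># (\<Sum>t\<in>T. filter_mset (P t) X)"
  proof (rule mset_subset_eqI)
    fix x
    show "count X x \<le> count (\<Sum>t\<in>T. filter_mset (P t) X) x"
    proof (cases "x \<in># X")
      case True
      then obtain t where t: "t \<in> T" "P t x" using assms(2) by blast
      then have "count X x = count (filter_mset (P t) X) x" by simp
      also have "\<dots> \<le> (\<Sum>t\<in>T. count (filter_mset (P t) X) x)"
        using t(1) assms(1) by (intro member_le_sum) auto
      finally show ?thesis by (simp add: count_sum)
    qed (simp add: not_in_iff)
  qed
  then show ?thesis
    using size_mset_mono by (fastforce simp: size_multiset_sum)
qed

lemma halfplane_depth_remove:
  fixes p :: pt
  assumes depth: "\<And>u. m \<le> size {#x \<in># X. u \<bullet> (x - p) \<le> 0#}" and "3 * m < size X"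
  obtains x where "x \<in># X" "\<And>u. m \<le> size {#y \<in># X - {#x#}. u \<bullet> (y - p) \<le> 0#}"
proof (rule ccontr)
  assume "\<not> thesis"
  then have "\<forall>x\<in>#X. \<exists>u. size {#y \<in># X - {#x#}. u \<bullet> (y - p) \<le> 0#} < m"
    using that by (meson not_le)
  then obtain u where u: "\<And>x. x \<in># X \<Longrightarrow> size {#y \<in># X - {#x#}. u x \<bullet> (y - p) \<le> 0#} < m"
    by metis
  \<comment> \<open>Removing \<open>x\<close> takes the half-plane of \<open>u x\<close> from at
    least \<open>m\<close> points to fewer, so \<open>x\<close> lies in it and it holds exactly
    \<open>m\<close>.\<close>
  have tight: "u x \<bullet> (x - p) \<le> 0" "size {#y \<in># X. u x \<bullet> (y - p) \<le> 0#} \<le> m" if "x \<in># X" for x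
  proof -
    have X: "X = add_mset x (X - {#x#})" using that by simp
    show "u x \<bullet> (x - p) \<le> 0"
      using u[OF that] depth[of "u x"] by (subst (asm) (2) X) (auto split: if_splits)
    then show "size {#y \<in># X. u x \<bullet> (y - p) \<le> 0#} \<le> m"
      using u[OF that] by (subst X) auto
  qed
  obtain T where T: "T \<subseteq> u ` set_mset X" "card T \<le> 3"
    "\<And>v z. \<lbrakk>v \<in> u ` set_mset X; v \<bullet> z \<le> 0\<rbrakk> \<Longrightarrow> \<exists>t\<in>T. t \<bullet> z \<le> 0"
    using halfplane_cover_3[of "u ` set_mset X"] by auto
  have "size X \<le> (\<Sum>t\<in>T. size {#y \<in># X. t \<bullet> (y - p) \<le> 0#})"
  proof (rule size_le_sum_filter)
    show "finite T" using T(1) finite_subset by auto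
    show "\<exists>t\<in>T. t \<bullet> (x - p) \<le> 0" if "x \<in># X" for x
      using T(3)[of "u x" "x - p"] tight(1)[OF that] that by auto
  qed
  also have "\<dots> \<le> (\<Sum>t\<in>T. m)"
    using T(1) tight(2) by (intro sum_mono) auto
  also have "\<dots> \<le> 3 * m" using T(2) by simp
  finally show False using assms(2) by simp
qed

section \<open>Angular order and Birch's triangles\<close>

lemma cos_gt_zero_iff:
  assumes "\<bar>t\<bar> < 2 * pi"
  shows "cos t > 0 \<longleftrightarrow> \<bar>t\<bar> < pi / 2 \<or> 3 * pi / 2 < \<bar>t\<bar>"
proof -
  consider "\<bar>t\<bar> < pi / 2" | "pi / 2 \<le> \<bar>t\<bar>" "\<bar>t\<bar> \<le> 3 * pi / 2" | "3 * pi / 2 < \<bar>t\<bar>" by linarith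
  then show ?thesis
  proof cases
    case 1
    then show ?thesis by (auto intro: cos_gt_zero_pi)
  next
    case 2
    then have "0 \<le> cos (\<bar>t\<bar> - pi)" by (intro cos_ge_zero) auto
    then have "cos t \<le> 0" by (simp add: cos_abs_real)
    then show ?thesis using 2 by auto
  next
    case 3
    then have "0 < cos (2 * pi - \<bar>t\<bar>)" using assms by (intro cos_gt_zero_pi) auto
    then show ?thesis using 3 by (simp add: cos_diff)
  qed
qed

text \<open>The directions with nonpositive cosine form a half-circle, and membership in an arc
  cannot go in, out, in, out along four points in cyclic order.\<close>

lemma cos_no_alternation:
  assumes "0 \<le> \<phi>" "\<phi> < 2 * pi" "0 \<le> a" "a \<le> b" "b \<le> c" "c \<le> d" "d < 2 * pi"
    and "cos (a - \<phi>) \<le> 0 \<longleftrightarrow> cos (c - \<phi>) \<le> 0" "cos (b - \<phi>) \<le> 0 \<longleftrightarrow> cos (d - \<phi>) \<le> 0"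
  shows "cos (a - \<phi>) \<le> 0 \<longleftrightarrow> cos (b - \<phi>) \<le> 0"
proof -
  have *: "cos (t - \<phi>) \<le> 0 \<longleftrightarrow> \<not> (\<bar>t - \<phi>\<bar> < pi / 2 \<or> 3 * pi / 2 < \<bar>t - \<phi>\<bar>)"
    if "0 \<le> t" "t < 2 * pi" for t
    using cos_gt_zero_iff[of "t - \<phi>"] that assms(1,2) by linarith
  note ends = assms(3-9) assms(1,2) pi_gt_zero
  \<comment> \<open>In the middle case the half-circle contains the direction 0 and appears as two
    intervals of angles; in the other cases it is one interval.\<close>
  consider "\<phi> < pi / 2" | "pi / 2 \<le> \<phi>" "\<phi> \<le> 3 * pi / 2" | "3 * pi / 2 < \<phi>"
    by linarith
  then show ?thesis
  proof cases
    case 1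
    have "cos (t - \<phi>) \<le> 0 \<longleftrightarrow> \<phi> + pi / 2 \<le> t \<and> t \<le> \<phi> + 3 * pi / 2"
      if "0 \<le> t" "t < 2 * pi" for t
      using *[OF that] that 1 pi_gt_zero by argo
    from this[of a] this[of b] this[of c] this[of d] show ?thesis using ends by argo
  next
    case 2
    have "cos (t - \<phi>) \<le> 0 \<longleftrightarrow> \<phi> + pi / 2 \<le> t \<or> t \<le> \<phi> - pi / 2"
      if "0 \<le> t" "t < 2 * pi" for t
      using *[OF that] that 2 pi_gt_zero by argo
    from this[of a] this[of b] this[of c] this[of d] show ?thesis using ends by argo
  next
    case 3
    have "cos (t - \<phi>) \<le> 0 \<longleftrightarrow> \<phi> - 3 * pi / 2 \<le> t \<and> t \<le> \<phi> - pi / 2"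
      if "0 \<le> t" "t < 2 * pi" for t
      using *[OF that] that 3 pi_gt_zero by argo
    from this[of a] this[of b] this[of c] this[of d] show ?thesis using ends by argo
  qed
qed

lemma polar_pt:
  obtains t where "0 \<le> t" "t < 2 * pi" "(z :: pt) $ 1 = norm z * cos t" "z $ 2 = norm z * sin t"
proof (cases "z = 0")
  case True
  then show ?thesis using that[of 0] by simp
next
  case False
  have "(z $ 1 / norm z)\<^sup>2 + (z $ 2 / norm z)\<^sup>2 = (z \<bullet> z) / (norm z)\<^sup>2"
    by (simp add: inner_pt power2_eq_square add_divide_distrib power_divide)
  also have "\<dots> = 1" using False by (simp add: power2_norm_eq_inner)
  finally obtain t where "0 \<le> t" "t < 2 * pi" "z $ 1 / norm z = cos t" "z $ 2 / norm z = sin t"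
    using sincos_total_2pi by metis
  then show ?thesis using that[of t] False by (simp add: field_simps)
qed

lemma polar_inner:
  fixes z u :: pt
  assumes "z $ 1 = norm z * cos t" "z $ 2 = norm z * sin t"
    "u $ 1 = norm u * cos \<phi>" "u $ 2 = norm u * sin \<phi>"
  shows "u \<bullet> z = norm u * norm z * cos (t - \<phi>)"
  unfolding inner_pt by (subst assms)+ (simp add: cos_diff algebra_simps)

text \<open>If \<open>p\<close> missed a triangle, some half-plane at \<open>p\<close> would avoid
  its three vertices. As a half-circle of directions, it meets only one of the three gaps between
  them in the angular order, and a gap holds only \<open>m - 1\<close> points.\<close>

lemma tverberg_3m:
  fixes p :: pt
  assumes depth: "\<And>u. m \<le> size {#x \<in># X. u \<bullet> (x - p) \<le> 0#}"
    and size: "size X = 3 * m" and "p \<notin># X"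
  obtains A where "(\<Sum>i<m. A i) = X" "\<And>i. i < m \<Longrightarrow> p \<in> convex hull (set_mset (A i))"
proof -
  have "\<forall>x. \<exists>t. 0 \<le> t \<and> t < 2 * pi \<and> (x - p) $ 1 = norm (x - p) * cos t \<and>
      (x - p) $ 2 = norm (x - p) * sin t"
    using polar_pt by metis
  then obtain f where f: "\<And>x. 0 \<le> f x" "\<And>x. f x < 2 * pi"
    "\<And>x. (x - p) $ 1 = norm (x - p) * cos (f x)" "\<And>x. (x - p) $ 2 = norm (x - p) * sin (f x)"
    by metis
  define xs where "xs = sort_key f (SOME ys. mset ys = X)"
  have X: "mset xs = X"
    unfolding xs_def by (metis (mono_tags) ex_mset mset_sort someI_ex)
  have len: "length xs = 3 * m" using X size by (metis size_mset)
  have mono: "f (xs ! j) \<le> f (xs ! k)" if "j \<le> k" "k < 3 * m" for j k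
  proof -
    have "sorted (map f xs)" unfolding xs_def by simp
    then show ?thesis using that len by (auto simp: sorted_iff_nth_mono)
  qed
  have "p \<in> convex hull {xs ! i, xs ! (m + i), xs ! (m + m + i)}" if "i < m" for i
  proof (rule ccontr)
    let ?C = "convex hull {xs ! i, xs ! (m + i), xs ! (m + m + i)}"
    assume "p \<notin> ?C"
    moreover have "closed ?C" by (simp add: compact_imp_closed finite_imp_compact_convex_hull)
    ultimately obtain u b where u: "u \<bullet> p < b" "\<forall>x\<in>?C. u \<bullet> x > b"
      using separating_hyperplane_closed_point[of ?C p] convex_convex_hull by metis
    define J where "J = {j. j < 3 * m \<and> u \<bullet> (xs ! j - p) \<le> 0}"
    have "size {#x \<in># X. u \<bullet> (x - p) \<le> 0#} = card J"
      unfolding X[symmetric] mset_filter[symmetric] size_mset length_filter_conv_card J_def len ..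
    then have card: "m \<le> card J" using depth by metis
    have "\<forall>x\<in>{xs ! i, xs ! (m + i), xs ! (m + m + i)}. 0 < u \<bullet> (x - p)"
      using u hull_subset[of "{xs ! i, xs ! (m + i), xs ! (m + m + i)}" convex]
      by (force simp: inner_diff_right)
    then have notin: "i \<notin> J" "m + i \<notin> J" "m + m + i \<notin> J"
      by (auto simp: J_def not_le)
    have "u \<noteq> 0" using u hull_inc[of "xs ! i" "{xs ! i, xs ! (m + i), xs ! (m + m + i)}" convex] by force
    obtain \<phi> where \<phi>: "0 \<le> \<phi>" "\<phi> < 2 * pi" "u $ 1 = norm u * cos \<phi>" "u $ 2 = norm u * sin \<phi>"
      using polar_pt by blast
    have J: "j \<in> J \<longleftrightarrow> cos (f (xs ! j) - \<phi>) \<le> 0" if "j < 3 * m" for j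
    proof -
      \<comment> \<open>A point equal to \<open>p\<close> would belong to \<open>J\<close> whatever
        its angle; \<open>p \<notin># X\<close> excludes it.\<close>
      have "xs ! j \<noteq> p" using that len X assms(3) by (metis nth_mem_mset)
      moreover have "u \<bullet> (xs ! j - p) = norm u * norm (xs ! j - p) * cos (f (xs ! j) - \<phi>)"
        using f \<phi> by (intro polar_inner)
      ultimately show ?thesis
        using \<open>u \<noteq> 0\<close> that by (simp add: J_def mult_le_0_iff)
    qed
    have alt: "a \<in> J \<longleftrightarrow> b \<in> J"
      if "a \<le> b" "b \<le> c" "c \<le> d" "d < 3 * m" "a \<in> J \<longleftrightarrow> c \<in> J" "b \<in> J \<longleftrightarrow> d \<in> J" for a b c d
      using cos_no_alternation[OF \<phi>(1,2) f(1) mono mono mono f(2), of a b c d] that J by simp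
    have *: "J \<subseteq> {i<..<m + i} \<or> J \<subseteq> {m + i<..<m + m + i} \<or> J \<subseteq> {..<i} \<union> {m + m + i<..<3 * m}"
    proof -
      let ?B1 = "{i<..<m + i}" and ?B2 = "{m + i<..<m + m + i}" and ?B3 = "{..<i} \<union> {m + m + i<..<3 * m}"
      have cover: "J \<subseteq> ?B1 \<union> ?B2 \<union> ?B3"
      proof
        fix j assume "j \<in> J"
        then have "j \<noteq> i" "j \<noteq> m + i" "j \<noteq> m + m + i" "j < 3 * m" using notin by (auto simp: J_def)
        then show "j \<in> ?B1 \<union> ?B2 \<union> ?B3"
          unfolding Un_iff greaterThanLessThan_iff lessThan_iff by linarith
      qed
      \<comment> \<open>Indices of \<open>J\<close> in two different gaps give, together with two
        vertices outside \<open>J\<close>, an alternating quadruple. The third gap wraps around, so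
        it needs one instance before \<open>i\<close> and one after
        \<open>m + m + i\<close>.\<close>
      have 12: False if "j \<in> J" "j \<in> ?B1" "k \<in> J" "k \<in> ?B2" for j k
        using alt[of j "m + i" k "m + m + i"] that notin \<open>i < m\<close> by auto
      have 13: False if "j \<in> J" "j \<in> ?B1" "k \<in> J" "k \<in> ?B3" for j k
        using alt[of k i j "m + i"] alt[of i j "m + i" k] that notin \<open>i < m\<close> by auto
      have 23: False if "j \<in> J" "j \<in> ?B2" "k \<in> J" "k \<in> ?B3" for j k
        using alt[of k i j "m + m + i"] alt[of "m + i" j "m + m + i" k] that notin \<open>i < m\<close> by auto
      show ?thesis using cover 12 13 23 by blast
    qed
    have "card ({..<i} \<union> {m + m + i<..<3 * m}) \<le> i + (3 * m - Suc (m + m + i))"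
      by (rule order_trans[OF card_Un_le]) simp
    then have "card J \<le> m - 1"
      using * \<open>i < m\<close> by (elim disjE) (fastforce dest: card_mono[rotated])+
    then show False using card \<open>i < m\<close> by simp
  qed
  moreover have "(\<Sum>i<m. {#xs ! i, xs ! (m + i), xs ! (m + m + i)#}) = X"
  proof -
    have "X = (\<Sum>i<m + m + m. {#xs ! i#})"
      unfolding X[symmetric] sum_nth_mset[symmetric] len by (simp add: numeral_3_eq_3 add.assoc)
    also have "\<dots> = (\<Sum>i<m. {#xs ! i#} + {#xs ! (m + i)#} + {#xs ! (m + m + i)#})"
      unfolding sum_lessThan_add by (simp only: sum.distrib)
    also have "\<dots> = (\<Sum>i<m. {#xs ! i, xs ! (m + i), xs ! (m + m + i)#})"
      by (simp add: add_mset_commute)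
    finally show ?thesis ..
  qed
  ultimately show ?thesis
    by (intro that[of "\<lambda>i. {#xs ! i, xs ! (m + i), xs ! (m + m + i)#}"]) auto
qed

text \<open>Induction on the number of points. An occurrence of \<open>p\<close> becomes a part of
  its own, which costs each half-plane one point and leaves one part fewer; surplus points are
  discarded; at \<open>3 * m\<close> points different from \<open>p\<close> Birch's argument
  applies.\<close>

lemma tverberg_depth:
  fixes p :: pt
  assumes "\<And>u. m \<le> size {#x \<in># X. u \<bullet> (x - p) \<le> 0#}" "3 * m \<le> size X"
  shows "\<exists>A. (\<Sum>i<m. A i) \<subseteq># X \<and> (\<forall>i<m. p \<in> convex hull (set_mset (A i)))"
  using assms
proof (induction "size X" arbitrary: X m rule: less_induct)
  case less
  consider "m = 0" | "p \<in># X" "0 < m" | "3 * m < size X" | "p \<notin># X" "size X = 3 * m"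
    using less.prems(2) by linarith
  then show ?case
  proof cases
    case 1
    then show ?thesis by auto
  next
    case 2
    then obtain Y k where Y: "X = add_mset p Y" and k: "m = Suc k"
      by (metis mset_add gr0_conv_Suc)
    have "\<exists>A. (\<Sum>i<k. A i) \<subseteq># Y \<and> (\<forall>i<k. p \<in> convex hull (set_mset (A i)))"
      using less.prems by (intro less.hyps) (auto simp: Y k)
    then obtain A where A: "(\<Sum>i<k. A i) \<subseteq># Y" "\<forall>i<k. p \<in> convex hull (set_mset (A i))" by blast
    have "(\<Sum>i<m. (A(k := {#p#})) i) = add_mset p (\<Sum>i<k. A i)"
      by (simp add: k)
    then show ?thesis
      using A by (intro exI[of _ "A(k := {#p#})"]) (auto simp: Y k less_Suc_eq)
  next
    case 3
    then obtain x where x: "x \<in># X" "\<And>u. m \<le> size {#y \<in># X - {#x#}. u \<bullet> (y - p) \<le> 0#}"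
      using halfplane_depth_remove[OF less.prems(1)] by blast
    have "\<exists>A. (\<Sum>i<m. A i) \<subseteq># X - {#x#} \<and> (\<forall>i<m. p \<in> convex hull (set_mset (A i)))"
      using x 3 by (intro less.hyps) (auto simp: size_Diff_singleton size_Diff1_less)
    then show ?thesis
      by (meson diff_subset_eq_self subset_mset.order_trans)
  next
    case 4
    then show ?thesis
      using tverberg_3m[OF less.prems(1)] by (metis subset_mset.order_refl)
  qed
qed

text \<open>The first bound on \<open>n\<close> gives a point of depth \<open>m\<close>, the second
  leaves enough points for triangles. For \<open>m = 2\<close> and \<open>h = 4\<close> the second
  is the stronger one.\<close>

lemma tv_prop_large:
  assumes "helly_prop S h" "h * (m - 1) < n" "3 * m \<le> n" "0 < m"
  shows "tv_prop S m n"
  unfolding tv_prop_def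
proof (intro allI impI)
  fix M :: "pt multiset" assume M: "size M = n" "set_mset M \<subseteq> S"
  obtain p where p: "p \<in> S" "\<And>u. m \<le> size {#x \<in># M. u \<bullet> (x - p) \<le> 0#}"
    using helly_prop_centerpoint[OF assms(1)] assms(2) M by metis
  then show "tverberg_partitionable S m M"
    using tverberg_depth[OF p(2)] p(1) tverberg_partitionableI[of m _ M p S] assms(3,4) M(1) by blast
qed

section \<open>Tverberg's theorem\<close>

text \<open>For nonempty \<open>V\<close> this is the direction space of the affine hull. Taking all
  differences avoids a base point and makes monotonicity immediate.\<close>

definition diff_span :: "'a::euclidean_space set \<Rightarrow> 'a set" where
  "diff_span V = span {v - w | v w. v \<in> V \<and> w \<in> V}"

lemma subspace_diff_span: "subspace (diff_span V)"
  by (simp add: diff_span_def)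

lemma diff_span_mono: "V \<subseteq> W \<Longrightarrow> diff_span V \<subseteq> diff_span W"
  unfolding diff_span_def by (rule span_mono) blast

lemma diff_span_eq:
  assumes "a \<in> V"
  shows "diff_span V = span ((\<lambda>v. - a + v) ` V)"
proof
  have "v - w \<in> span ((\<lambda>v. - a + v) ` V)" if "v \<in> V" "w \<in> V" for v w
  proof -
    have "(- a + v) - (- a + w) \<in> span ((\<lambda>v. - a + v) ` V)"
      using that by (intro span_diff span_base) auto
    then show ?thesis by simp
  qed
  then show "diff_span V \<subseteq> span ((\<lambda>v. - a + v) ` V)"
    unfolding diff_span_def by (intro span_minimal subspace_span) auto
  show "span ((\<lambda>v. - a + v) ` V) \<subseteq> diff_span V"
    unfolding diff_span_def using assms by (intro span_mono) force
qed

lemma dim_diff_span: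
  assumes "V \<noteq> {}"
  shows "int (dim (diff_span V)) = aff_dim V"
proof -
  obtain a where a: "a \<in> V" using assms by blast
  then have "aff_dim V = int (dim ((\<lambda>v. - a + v) ` V))"
    by (intro aff_dim_eq_dim hull_inc)
  then show ?thesis unfolding diff_span_eq[OF a] by simp
qed

lemma diff_in_diff_span:
  assumes "x \<in> convex hull V" "y \<in> convex hull V"
  shows "x - y \<in> diff_span V"
proof -
  obtain a where a: "a \<in> V" using assms(1) by fastforce
  have "convex {z. z - a \<in> diff_span V}"
  proof (rule convexI)
    fix z w :: 'a and s t :: real
    assume "z \<in> {z. z - a \<in> diff_span V}" "w \<in> {z. z - a \<in> diff_span V}" "s + t = 1"
    moreover have "s *\<^sub>R z + t *\<^sub>R w - a = s *\<^sub>R (z - a) + t *\<^sub>R (w - a)"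
      using \<open>s + t = 1\<close> by (simp add: algebra_simps scaleR_left_distrib[symmetric])
    ultimately show "s *\<^sub>R z + t *\<^sub>R w \<in> {z. z - a \<in> diff_span V}"
      by (simp add: subspace_diff_span subspace_add subspace_scale)
  qed
  moreover have "V \<subseteq> {z. z - a \<in> diff_span V}"
    unfolding diff_span_def using a by (auto intro: span_base)
  ultimately have "convex hull V \<subseteq> {z. z - a \<in> diff_span V}" by (rule hull_minimal[rotated])
  then have "(x - a) - (y - a) \<in> diff_span V"
    using assms by (intro subspace_diff[OF subspace_diff_span, of "x - a" V "y - a"]) auto
  then show ?thesis by simp
qed

lemma diff_span_explicit:
  assumes "finite V" "u \<in> diff_span V"
  obtains d where "sum d V = 0" "u = (\<Sum>v\<in>V. d v *\<^sub>R v)"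
proof -
  have "\<exists>d. sum d V = 0 \<and> u = (\<Sum>v\<in>V. d v *\<^sub>R v)"
    using assms(2) unfolding diff_span_def
  proof (induction rule: span_induct_alt)
    case base
    then show ?case by (intro exI[of _ "\<lambda>_. 0"]) simp
  next
    case (step c x y)
    then obtain v w d where vw: "x = v - w" "v \<in> V" "w \<in> V"
      and d: "sum d V = 0" "y = (\<Sum>v\<in>V. d v *\<^sub>R v)" by blast
    let ?d = "\<lambda>z. (if z = v then c else 0) - (if z = w then c else 0) + d z"
    have "sum ?d V = 0"
      using assms(1) vw d by (simp add: sum.distrib sum_subtractf)
    moreover have "c *\<^sub>R x + y = (\<Sum>v\<in>V. ?d v *\<^sub>R v)"
      using assms(1) vw d
      by (simp add: sum.distrib sum_subtractf scaleR_left_distrib scaleR_left_diff_distrib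
          scaleR_right_diff_distrib if_distrib[where f = "\<lambda>c. c *\<^sub>R _"] cong: if_cong)
    ultimately show ?case by blast
  qed
  then show ?thesis using that by blast
qed

section \<open>Points in the hull of a minimal carrying set\<close>

lemma minimal_hull_coeffs:
  assumes "finite V" "y \<in> convex hull V" "\<And>v. v \<in> V \<Longrightarrow> y \<notin> convex hull (V - {v})"
  obtains c where "\<And>v. v \<in> V \<Longrightarrow> 0 < c v" "sum c V = 1" "(\<Sum>v\<in>V. c v *\<^sub>R v) = (y :: 'a :: euclidean_space)"
proof -
  obtain c where c: "\<forall>v\<in>V. 0 \<le> c v" "sum c V = 1" "(\<Sum>v\<in>V. c v *\<^sub>R v) = y"
    using assms(2) unfolding convex_hull_finite[OF assms(1)] by blast
  have "c v \<noteq> 0" if "v \<in> V" for v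
  proof
    assume "c v = 0"
    then have "sum c (V - {v}) = 1" "(\<Sum>v\<in>V - {v}. c v *\<^sub>R v) = y"
      using c that assms(1) by (simp_all add: sum_diff1)
    then have "y \<in> convex hull (V - {v})"
      using c(1) assms(1) by (auto simp: convex_hull_finite)
    then show False using assms(3) that by blast
  qed
  then show ?thesis using that[of c] c by (metis less_eq_real_def)
qed

text \<open>Caratheodory's theorem in the affine hull yields a small carrying subset, which by
  minimality is all of \<open>V\<close>.\<close>

lemma minimal_hull_card:
  fixes y :: "'a :: euclidean_space"
  assumes "finite V" "y \<in> convex hull V" "\<And>v. v \<in> V \<Longrightarrow> y \<notin> convex hull (V - {v})"
  shows "int (card V) \<le> int (dim (diff_span V)) + 1"
proof -
  obtain T where T: "T \<subseteq> V" "int (card T) \<le> aff_dim V + 1" "y \<in> convex hull T"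
    using assms(2) unfolding caratheodory_aff_dim[of V] by blast
  have "T = V"
  proof (rule ccontr)
    assume "T \<noteq> V"
    then obtain v where "v \<in> V" "T \<subseteq> V - {v}" using T(1) by blast
    then show False using assms(3)[of v] T(3) hull_mono[of T "V - {v}" convex] by blast
  qed
  moreover have "V \<noteq> {}" using assms(2) by auto
  ultimately show ?thesis using T(2) dim_diff_span[of V] by simp
qed

text \<open>By minimality all coefficients of \<open>y\<close> are positive, so \<open>y\<close> is
  a relative interior point, and small steps along directions of the affine hull keep the
  coefficients nonnegative.\<close>

lemma minimal_hull_move:
  assumes "finite V" "y \<in> convex hull V" "\<And>v. v \<in> V \<Longrightarrow> y \<notin> convex hull (V - {v})"
    and "u \<in> diff_span V"
  obtains e where "0 < e" "\<And>t. \<bar>t\<bar> \<le> e \<Longrightarrow> y + t *\<^sub>R u \<in> convex hull V"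
proof -
  obtain c where c: "\<And>v. v \<in> V \<Longrightarrow> 0 < c v" "sum c V = 1" "(\<Sum>v\<in>V. c v *\<^sub>R v) = y"
    using minimal_hull_coeffs[OF assms(1-3)] by metis
  obtain d where d: "sum d V = 0" "u = (\<Sum>v\<in>V. d v *\<^sub>R v)"
    using diff_span_explicit[OF assms(1,4)] by metis
  have "V \<noteq> {}" using assms(2) by auto
  \<comment> \<open>The 1 in the denominator guards against \<open>d v = 0\<close>.\<close>
  define e where "e = Min ((\<lambda>v. c v / (1 + \<bar>d v\<bar>)) ` V)"
  have e: "e * (1 + \<bar>d v\<bar>) \<le> c v" if "v \<in> V" for v
  proof -
    have "e \<le> c v / (1 + \<bar>d v\<bar>)" unfolding e_def using assms(1) that by (intro Min_le) auto
    then show ?thesis by (simp add: pos_le_divide_eq)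
  qed
  have pos: "0 < e"
    unfolding e_def using assms(1) \<open>V \<noteq> {}\<close> c(1) by (subst Min_gr_iff) (auto simp: add_pos_nonneg)
  have "y + t *\<^sub>R u \<in> convex hull V" if "\<bar>t\<bar> \<le> e" for t
  proof -
    have "0 \<le> c v + t * d v" if "v \<in> V" for v
    proof -
      have "\<bar>t * d v\<bar> \<le> e * \<bar>d v\<bar>" unfolding abs_mult using \<open>\<bar>t\<bar> \<le> e\<close> by (intro mult_right_mono) auto
      then show ?thesis using e[OF that] pos by (simp add: distrib_left)
    qed
    moreover have "(\<Sum>v\<in>V. c v + t * d v) = 1"
      using c d by (simp add: sum.distrib sum_distrib_left[symmetric])
    moreover have "(\<Sum>v\<in>V. (c v + t * d v) *\<^sub>R v) = y + t *\<^sub>R u"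
      using c d by (simp add: scaleR_left_distrib sum.distrib scaleR_right.sum)
    ultimately show ?thesis
      unfolding convex_hull_finite[OF assms(1)] by (intro CollectI exI[of _ "\<lambda>v. c v + t * d v"]) simp
  qed
  then show ?thesis using that pos by blast
qed

lemma sum_zero_in_direct_sum:
  fixes N :: "'i \<Rightarrow> 'a::euclidean_space set"
  assumes fin: "finite I" and sub: "\<And>i. i \<in> I \<Longrightarrow> subspace (N i)"
    and L: "L \<subseteq> span (\<Union>i\<in>I. N i)" and dim: "(\<Sum>i\<in>I. dim (N i)) \<le> dim L"
    and n: "\<And>i. i \<in> I \<Longrightarrow> n i \<in> N i" "(\<Sum>i\<in>I. n i) = 0" and k: "k \<in> I"
  shows "n k = 0"
proof (rule ccontr)
  assume "n k \<noteq> 0"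
  then have "independent {n k}" by simp
  then obtain Bk where Bk: "{n k} \<subseteq> Bk" "Bk \<subseteq> N k" "independent Bk" "N k \<subseteq> span Bk"
    using maximal_independent_subset_extend[of "{n k}" "N k"] n(1)[OF k] by auto
  have "\<forall>i. \<exists>B\<subseteq>N i. independent B \<and> N i \<subseteq> span B \<and> card B = dim (N i)"
    by (metis basis_exists)
  then obtain B where B: "\<And>i. B i \<subseteq> N i" "\<And>i. independent (B i)" "\<And>i. N i \<subseteq> span (B i)"
    "\<And>i. card (B i) = dim (N i)" by metis
  define W where "W = (Bk - {n k}) \<union> (\<Union>i\<in>I - {k}. B i)"
  have finW: "finite W"
    unfolding W_def using fin Bk(3) B(2) by (auto simp: independent_imp_finite)
  have other: "N i \<subseteq> span W" if "i \<in> I - {k}" for i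
    using B(3)[of i] span_mono[of "B i" W] that unfolding W_def by blast
  have "n k = - (\<Sum>i\<in>I - {k}. n i)"
    using n(2) fin k by (simp add: sum.remove eq_neg_iff_add_eq_0)
  also have "\<dots> \<in> span W"
    using other n(1) by (intro span_neg span_sum) blast
  finally have "n k \<in> span W" .
  moreover have "Bk - {n k} \<subseteq> span W"
    using span_superset[of W] unfolding W_def by blast
  ultimately have "Bk \<subseteq> span W" by blast
  then have "N k \<subseteq> span W"
    using Bk(4) span_minimal[OF _ subspace_span, of Bk W] by blast
  then have "(\<Union>i\<in>I. N i) \<subseteq> span W" using other by blast
  then have "L \<subseteq> span W" using L span_minimal by blast
  then have "dim L \<le> card W" using finW by (rule dim_le_card)
  also have "\<dots> \<le> card (Bk - {n k}) + card (\<Union>i\<in>I - {k}. B i)"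
    unfolding W_def by (rule card_Un_le)
  also have "\<dots> \<le> card (Bk - {n k}) + (\<Sum>i\<in>I - {k}. card (B i))"
    using fin by (intro add_left_mono card_UN_le) auto
  also have "\<dots> < card Bk + (\<Sum>i\<in>I - {k}. card (B i))"
    using Bk(1) independent_imp_finite[OF Bk(3)] by (intro add_strict_right_mono card_Diff1_less) auto
  also have "card Bk = dim (N k)"
    using Bk sub k by (metis basis_card_eq_dim)
  also have "dim (N k) + (\<Sum>i\<in>I - {k}. card (B i)) = (\<Sum>i\<in>I. dim (N i))"
    using fin k by (simp add: sum.remove B(4))
  finally show False using dim by simp
qed


text \<open>
  Roudneff's proof of Tverberg's theorem: minimise the sum of the squared distances from a point \<open>x\<close> to
  the hulls of the parts, over all points and all partitions.
\<close>

definition part_energy :: "nat \<Rightarrow> (nat \<Rightarrow> 'a::euclidean_space multiset) \<Rightarrow> 'a \<Rightarrow> real" where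
  "part_energy m A x = (\<Sum>i<m. (infdist x (convex hull (set_mset (A i))))\<^sup>2)"

text \<open>Since \<open>infdist\<close> to the empty set is 0, an empty part would count as already
  reached by \<open>x\<close>. The empty tail leaves only finitely many functions, so a least energy
  exists.\<close>

definition proper_partition :: "nat \<Rightarrow> 'a multiset \<Rightarrow> (nat \<Rightarrow> 'a multiset) \<Rightarrow> bool" where
  "proper_partition m M A \<longleftrightarrow> (\<Sum>i<m. A i) = M \<and> (\<forall>i<m. A i \<noteq> {#}) \<and> (\<forall>i\<ge>m. A i = {#})"

lemma proper_partition_subset:
  assumes "proper_partition m M A"
  shows "A i \<subseteq># M"
proof (cases "i < m")
  case True
  then show ?thesis
    using assms unfolding proper_partition_def by (metis finite_lessThan lessThan_iff mset_subset_eq_add_left sum.remove)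
next
  case False
  then show ?thesis using assms by (simp add: proper_partition_def)
qed

lemma finite_proper_partitions: "finite {A. proper_partition m M A}"
proof (rule finite_subset)
  show "{A. proper_partition m M A} \<subseteq>
      {A. \<forall>i. (i \<in> {..<m} \<longrightarrow> A i \<in> {N. N \<subseteq># M}) \<and> (i \<notin> {..<m} \<longrightarrow> A i = {#})}"
    using proper_partition_subset by (auto simp: proper_partition_def)
  show "finite \<dots>"
    by (intro finite_set_of_finite_funs finite_submsets) auto
qed

lemma ex_proper_partition:
  assumes "m \<le> size M" "0 < m"
  shows "\<exists>A. proper_partition m M A"
proof -
  obtain N where N: "N \<subseteq># M" "size N = m" using ex_submset[OF assms(1)] by blast
  obtain xs where xs: "mset xs = N" using ex_mset by blast
  define A where "A i = (if i < m then {#xs ! i#} else {#})" for i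
  have "(\<Sum>i<m. A i) = (\<Sum>i<length xs. {#xs ! i#})"
    using N(2) xs by (intro sum.cong) (auto simp: A_def)
  also have "\<dots> = N" unfolding sum_nth_mset xs ..
  finally obtain B where "(\<Sum>i<m. B i) = M" "\<And>i. A i \<subseteq># B i" "\<And>i. m \<le> i \<Longrightarrow> B i = A i"
    using extend_to_partition[OF assms(2), of A M] N(1) by metis
  moreover have "B i \<noteq> {#}" if "i < m" for i
    using calculation(2)[of i] that by (auto simp: A_def)
  ultimately have "proper_partition m M B"
    by (simp add: proper_partition_def A_def)
  then show ?thesis by blast
qed

lemma compact_hull_mset: "compact (convex hull (set_mset (N :: 'a::euclidean_space multiset)))"
  by (simp add: finite_imp_compact_convex_hull)

lemma part_energy_le:
  assumes "\<And>i. i < m \<Longrightarrow> y i \<in> convex hull (set_mset (A i))"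
  shows "part_energy m A x \<le> (\<Sum>i<m. (dist x (y i))\<^sup>2)"
  unfolding part_energy_def using assms
  by (intro sum_mono power_mono infdist_le infdist_nonneg) auto

lemma continuous_part_energy: "continuous_on X (part_energy m A)"
  unfolding part_energy_def by (intro continuous_intros)

lemma part_energy_minimizer:
  fixes A :: "nat \<Rightarrow> 'a::euclidean_space multiset"
  assumes part: "proper_partition m M A" and x: "x \<in> convex hull (set_mset M)"
    and min: "\<And>B z. \<lbrakk>proper_partition m M B; z \<in> convex hull (set_mset M)\<rbrakk> \<Longrightarrow>
        part_energy m A x \<le> part_energy m B z"
    and pos: "0 < part_energy m A x"
  obtains y where "\<And>i. i < m \<Longrightarrow> y i \<in> convex hull (set_mset (A i))"
    "part_energy m A x = (\<Sum>i<m. (dist x (y i))\<^sup>2)"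
    "x = (\<Sum>i<m. (1 / m) *\<^sub>R y i)"
    "\<And>i v. \<lbrakk>i < m; v \<in># A i\<rbrakk> \<Longrightarrow> y i \<notin> convex hull (set_mset (A i - {#v#}))"
    "\<And>i v. \<lbrakk>i < m; v \<in># A i\<rbrakk> \<Longrightarrow> (x - y i) \<bullet> (v - y i) = 0"
proof -
  have ne: "convex hull (set_mset (A i)) \<noteq> {}" if "i < m" for i
    using part that by (auto simp: proper_partition_def)
  have "\<forall>i. \<exists>z. i < m \<longrightarrow> z \<in> convex hull (set_mset (A i)) \<and>
      infdist x (convex hull (set_mset (A i))) = dist x z"
    using infdist_attains_inf[OF compact_imp_closed[OF compact_hull_mset] ne] by metis
  then obtain y where y: "\<And>i. i < m \<Longrightarrow> y i \<in> convex hull (set_mset (A i))"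
    and near: "\<And>i. i < m \<Longrightarrow> infdist x (convex hull (set_mset (A i))) = dist x (y i)"
    by metis
  have energy: "part_energy m A x = (\<Sum>i<m. (dist x (y i))\<^sup>2)"
    unfolding part_energy_def using near by simp
  have "0 < m" using pos by (cases m) (auto simp: part_energy_def)
  have yM: "y i \<in> convex hull (set_mset M)" if "i < m" for i
    using y[OF that] hull_mono[OF set_mset_mono[OF proper_partition_subset[OF part]]] by blast
  define c where "c = (\<Sum>i<m. (1 / m) *\<^sub>R y i)"
  have "c \<in> convex hull (set_mset M)"
    unfolding c_def using \<open>0 < m\<close> yM by (intro convex_sum) auto
  have sum_c: "(\<Sum>i<m. c - y i) = 0"
    using \<open>0 < m\<close> by (simp add: sum_subtractf c_def scaleR_right.sum[symmetric] sum_constant_scaleR)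
  \<comment> \<open>The parallel axis identity: the sum of squared distances exceeds its value at
    the centroid \<open>c\<close> by \<open>m * (dist x c)\<^sup>2\<close>.\<close>
  have "(\<Sum>i<m. (dist x (y i))\<^sup>2) = (\<Sum>i<m. (dist c (y i))\<^sup>2 + 2 * ((x - c) \<bullet> (c - y i)) + (dist x c)\<^sup>2)"
    by (intro sum.cong) (auto simp: dist_norm power2_norm_eq_inner inner_diff inner_commute algebra_simps)
  also have "\<dots> = (\<Sum>i<m. (dist c (y i))\<^sup>2) + 2 * ((x - c) \<bullet> (\<Sum>i<m. c - y i)) + m * (dist x c)\<^sup>2"
    by (simp add: sum.distrib inner_sum_right sum_distrib_left)
  finally have "part_energy m A c + m * (dist x c)\<^sup>2 \<le> part_energy m A x"
    using part_energy_le[of m y A c] y sum_c unfolding energy by simp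
  then have "m * (dist x c)\<^sup>2 \<le> 0"
    using min[OF part \<open>c \<in> _\<close>] by linarith
  then have xc: "x = c"
    using \<open>0 < m\<close> by (simp add: mult_le_0_iff)
  have obtuse: "(x - y i) \<bullet> (v - y i) \<le> 0" if "i < m" "v \<in> convex hull (set_mset (A i))" for i v
  proof (rule any_closest_point_dot[OF convex_convex_hull _ y[OF that(1)] that(2)])
    show "closed (convex hull (set_mset (A i)))" by (intro compact_imp_closed compact_hull_mset)
    show "\<forall>z\<in>convex hull (set_mset (A i)). dist x (y i) \<le> dist x z"
      using near[OF that(1)] by (metis infdist_le)
  qed
  have min_hull: "y i \<notin> convex hull (set_mset (A i - {#v#}))" if i: "i < m" "v \<in># A i" for i v
  proof
    assume yi: "y i \<in> convex hull (set_mset (A i - {#v#}))"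
    \<comment> \<open>As \<open>x\<close> is the centroid, this sum equals the energy, so some part
      \<open>j\<close> has a positive term: adding \<open>v\<close> to it brings its hull closer to
      \<open>x\<close>. The nearest-point inequality rules out \<open>j = i\<close>.\<close>
    have "(\<Sum>j<m. (x - y j) \<bullet> (v - y j)) = (\<Sum>j<m. (x - y j) \<bullet> (v - x) + (dist x (y j))\<^sup>2)"
      by (intro sum.cong) (auto simp: dist_norm power2_norm_eq_inner inner_diff inner_commute algebra_simps)
    also have "\<dots> = (\<Sum>j<m. x - y j) \<bullet> (v - x) + part_energy m A x"
      unfolding energy by (simp add: sum.distrib inner_sum_left)
    finally have "0 < (\<Sum>j<m. (x - y j) \<bullet> (v - y j))"
      using pos sum_c xc by simp
    moreover have "(\<Sum>j<m. (x - y j) \<bullet> (v - y j)) \<le> 0"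
      if "\<And>j. j < m \<Longrightarrow> (x - y j) \<bullet> (v - y j) \<le> 0"
      using that by (intro sum_nonpos) auto
    ultimately obtain j where j: "j < m" "0 < (x - y j) \<bullet> (v - y j)"
      by (meson not_le)
    then have "j \<noteq> i" using obtuse[of i v] i hull_inc by (metis not_le)
    obtain s where s: "0 < s" "s \<le> 1" "dist (y j + s *\<^sub>R (v - y j)) x < dist (y j) x"
      using closer_point_lemma[OF j(2)] by blast
    define y' where "y' = y(j := y j + s *\<^sub>R (v - y j))"
    define B where "B = A(i := A i - {#v#}, j := add_mset v (A j))"
    have "(\<Sum>k<m. B k) = B i + (B j + (\<Sum>k\<in>{..<m} - {i} - {j}. B k))"
      using i(1) j(1) \<open>j \<noteq> i\<close> by (subst sum.remove[of _ i], auto, subst sum.remove[of _ j], auto)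
    also have "\<dots> = A i + (A j + (\<Sum>k\<in>{..<m} - {i} - {j}. A k))"
      using i(2) \<open>j \<noteq> i\<close> by (simp add: B_def)
    also have "\<dots> = (\<Sum>k<m. A k)"
      using i(1) j(1) \<open>j \<noteq> i\<close> by (subst (2) sum.remove[of _ i], auto, subst (2) sum.remove[of _ j], auto)
    \<comment> \<open>Part \<open>i\<close> remains nonempty without \<open>v\<close>, since its
      hull still contains \<open>y i\<close>.\<close>
    finally have "proper_partition m M B"
      using part yi i(1) j(1) by (auto simp: proper_partition_def B_def)
    have "y' k \<in> convex hull (set_mset (B k))" if k: "k < m" for k
    proof (cases "k = j")
      case True
      have "y j \<in> convex hull (set_mset (B j))"
        using y[OF j(1)] hull_mono[of "set_mset (A j)" "set_mset (B j)"] by (auto simp: B_def)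
      moreover have "v \<in> convex hull (set_mset (B j))"
        by (intro hull_inc) (simp add: B_def)
      ultimately have "(1 - s) *\<^sub>R y j + s *\<^sub>R v \<in> convex hull (set_mset (B j))"
        using s by (intro convexD convex_convex_hull) auto
      then show ?thesis using True by (simp add: y'_def algebra_simps)
    next
      case False
      then show ?thesis using y[OF k] yi \<open>j \<noteq> i\<close> by (simp add: y'_def B_def)
    qed
    then have "part_energy m B x \<le> (\<Sum>k<m. (dist x (y' k))\<^sup>2)" by (rule part_energy_le)
    also have "\<dots> < (\<Sum>k<m. (dist x (y k))\<^sup>2)"
      using j(1) s(3)
      by (intro sum_strict_mono_ex1) (auto simp: y'_def dist_commute power_strict_mono less_imp_le
          intro!: bexI[of _ j])
    finally show False
      using min[OF \<open>proper_partition m M B\<close> x] energy by simp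
  qed
  have "(x - y i) \<bullet> (v - y i) = 0" if i: "i < m" "v \<in># A i" for i v
  proof -
    let ?V = "set_mset (A i)"
    have "y i \<notin> convex hull (?V - {v})" if "v \<in> ?V" for v
    proof -
      have "?V - {v} \<subseteq> set_mset (A i - {#v#})"
        by (auto simp: in_diff_count not_in_iff split: if_splits)
      then show ?thesis using min_hull[OF i(1) that] hull_mono by blast
    qed
    then obtain c where c: "\<And>v. v \<in> ?V \<Longrightarrow> 0 < c v" "sum c ?V = 1" "(\<Sum>v\<in>?V. c v *\<^sub>R v) = y i"
      using minimal_hull_coeffs[OF _ y[OF i(1)]] by auto
    \<comment> \<open>Nonpositive terms with positive weights add up to 0, since \<open>y i\<close>
      is the weighted mean of the part; so each term vanishes.\<close>
    have "(\<Sum>v\<in>?V. c v * ((x - y i) \<bullet> (v - y i))) = (x - y i) \<bullet> ((\<Sum>v\<in>?V. c v *\<^sub>R v) - sum c ?V *\<^sub>R y i)"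
      by (simp add: inner_sum_right inner_diff_right sum_subtractf sum_distrib_right right_diff_distrib
          scaleR_left.sum)
    also have "\<dots> = 0" using c by simp
    finally have "(\<Sum>v\<in>?V. - (c v * ((x - y i) \<bullet> (v - y i)))) = 0"
      by (simp add: sum_negf)
    then have "\<forall>v\<in>?V. - (c v * ((x - y i) \<bullet> (v - y i))) = 0"
      using c(1) obtuse[OF i(1) hull_inc]
      by (subst (asm) sum_nonneg_eq_0_iff) (auto simp: mult_le_0_iff less_imp_le)
    then show ?thesis using c(1) i(2) by fastforce
  qed
  then show ?thesis
    using that[OF y energy _ min_hull] xc c_def by blast
qed

text \<open>
  At a minimiser \<open>x\<close> with nearest points \<open>y i\<close>, the vector \<open>x - y i\<close> lies in the orthogonal complement
  \<open>N i\<close> of the directions of part \<open>i\<close>. By minimality no point of a part is superfluous, so the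
  dimensions of the \<open>N i\<close> add up to at most the affine dimension of all points. Either the \<open>N i\<close> span
  all directions, hence are independent, and \<open>\<Sum>i. x - y i = 0\<close> makes all distances vanish; or some direction \<open>u\<close>
  is common to all parts, and then \<open>x\<close> and all \<open>y i\<close> can be pushed along \<open>u\<close> at no cost, which is
  impossible for the minimiser maximising \<open>u \<bullet> x\<close>.
\<close>

theorem tverberg_aff_dim:
  fixes M :: "'a::euclidean_space multiset"
  assumes "0 < m" and size: "(aff_dim (set_mset M) + 1) * int (m - 1) < int (size M)"
  obtains A where "(\<Sum>i<m. A i) = M" "(\<Inter>i<m. convex hull (set_mset (A i))) \<noteq> {}"
proof -
  define K where "K = convex hull (set_mset M)"
  have "M \<noteq> {#}" using size by auto
  then have "0 \<le> aff_dim (set_mset M)"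
    by (metis aff_dim_negative_iff not_le set_mset_eq_empty_iff)
  then have "1 * int (m - 1) \<le> (aff_dim (set_mset M) + 1) * int (m - 1)"
    by (intro mult_right_mono) auto
  then have "m \<le> size M" using size by linarith
  have K: "compact K" "K \<noteq> {}"
    using \<open>M \<noteq> {#}\<close> by (simp_all add: K_def compact_hull_mset)
  \<comment> \<open>A best point is chosen for each partition first, then a best one among the
    finitely many partitions; together they form a global minimum.\<close>
  have "\<exists>x\<in>K. \<forall>z\<in>K. part_energy m A x \<le> part_energy m A z" for A
    by (intro continuous_attains_inf K continuous_part_energy)
  then obtain X where X: "\<And>A. X A \<in> K" "\<And>A z. z \<in> K \<Longrightarrow> part_energy m A (X A) \<le> part_energy m A z"
    by metis
  obtain A where A: "proper_partition m M A"
    "\<And>B. proper_partition m M B \<Longrightarrow> part_energy m A (X A) \<le> part_energy m B (X B)"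
  proof -
    let ?E = "(\<lambda>A. part_energy m A (X A)) ` {A. proper_partition m M A}"
    have "finite ?E" "?E \<noteq> {}"
      using finite_proper_partitions ex_proper_partition[OF \<open>m \<le> size M\<close> \<open>0 < m\<close>] by auto
    then have "Min ?E \<in> ?E" "\<And>e. e \<in> ?E \<Longrightarrow> Min ?E \<le> e" by auto
    then show ?thesis using that by force
  qed
  define g where "g = part_energy m A (X A)"
  have g_min: "g \<le> part_energy m B z" if "proper_partition m M B" "z \<in> K" for B z
    using A(2)[OF that(1)] X(2)[OF that(2), of B] by (simp add: g_def)
  have "g = 0"
  proof (rule ccontr)
    assume "g \<noteq> 0"
    moreover have "0 \<le> g" unfolding g_def part_energy_def by (intro sum_nonneg) auto
    ultimately have "0 < g" by simp
    \<comment> \<open>All points of least energy for the fixed partition \<open>A\<close>. The value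
      \<open>g\<close> is minimal over all partitions too, so each point of \<open>Z\<close>
      satisfies the conditions of \<open>part_energy_minimizer\<close>.\<close>
    define Z where "Z = K \<inter> {x. part_energy m A x = g}"
    have Z: "\<exists>y. (\<forall>i<m. y i \<in> convex hull (set_mset (A i))) \<and>
        part_energy m A x = (\<Sum>i<m. (dist x (y i))\<^sup>2) \<and>
        x = (\<Sum>i<m. (1 / m) *\<^sub>R y i) \<and>
        (\<forall>i<m. \<forall>v\<in>#A i. y i \<notin> convex hull (set_mset (A i - {#v#}))) \<and>
        (\<forall>i<m. \<forall>v\<in>#A i. (x - y i) \<bullet> (v - y i) = 0)" if "x \<in> Z" for x
    proof -
      have "x \<in> convex hull (set_mset M)" "part_energy m A x = g"
        using that by (auto simp: Z_def K_def)
      then show ?thesis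
        using part_energy_minimizer[OF A(1), of x] g_min \<open>0 < g\<close> unfolding K_def by metis
    qed
    let ?V = "\<lambda>i. set_mset (A i)"
    define L where "L = diff_span (set_mset M)"
    define D where "D i = diff_span (?V i)" for i
    define N where "N i = {z \<in> L. \<forall>w\<in>D i. orthogonal w z}" for i
    have sub: "subspace L" "subspace (D i)" "subspace (N i)" for i
    proof -
      show "subspace L" "subspace (D i)" by (simp_all add: L_def D_def subspace_diff_span)
      then show "subspace (N i)"
        unfolding N_def
        by (auto simp: subspace_def orthogonal_clauses)
    qed
    have DL: "D i \<subseteq> L" for i
      unfolding D_def L_def by (intro diff_span_mono set_mset_mono proper_partition_subset[OF A(1)])
    have "X A \<in> Z" using X(1) by (simp add: Z_def g_def)
    then obtain y where y: "\<And>i. i < m \<Longrightarrow> y i \<in> convex hull ?V i"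
      "part_energy m A (X A) = (\<Sum>i<m. (dist (X A) (y i))\<^sup>2)"
      "X A = (\<Sum>i<m. (1 / m) *\<^sub>R y i)"
      "\<And>i v. \<lbrakk>i < m; v \<in># A i\<rbrakk> \<Longrightarrow> y i \<notin> convex hull (set_mset (A i - {#v#}))"
      "\<And>i v. \<lbrakk>i < m; v \<in># A i\<rbrakk> \<Longrightarrow> (X A - y i) \<bullet> (v - y i) = 0"
      using Z by metis
    have minimal: "z \<notin> convex hull (?V i - {v})"
      if "z \<notin> convex hull (set_mset (A i - {#v#}))" "v \<in># A i" for i v z
    proof -
      have "?V i - {v} \<subseteq> set_mset (A i - {#v#})"
        by (auto simp: in_diff_count not_in_iff split: if_splits)
      then show ?thesis using that(1) hull_mono by blast
    qed
    have card: "size (A i) = card (?V i)" if "i < m" for i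
    proof -
      have "count (A i) v = 1" if "v \<in># A i" for v
      proof (rule ccontr)
        assume "count (A i) v \<noteq> 1"
        moreover have "0 < count (A i) v" using that by simp
        ultimately have "1 < count (A i) v" by linarith
        then have "set_mset (A i - {#v#}) = ?V i"
          using that by (auto simp: in_diff_count set_eq_iff)
        then show False using y(1,4) \<open>i < m\<close> that by metis
      qed
      then show ?thesis by (simp add: size_multiset_overloaded_eq)
    qed
    have dimN: "int (dim (N i)) \<le> int (dim L) + 1 - int (size (A i))" if i: "i < m" for i
    proof -
      have "dim (N i) + dim (D i) = dim L"
        unfolding N_def by (rule dim_subspace_orthogonal_to_vectors[OF sub(2,1) DL])
      moreover have "int (size (A i)) \<le> int (dim (D i)) + 1"
        unfolding D_def card[OF i] using minimal_hull_card[OF _ y(1)[OF i] minimal] y(4) i by auto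
      ultimately show ?thesis by linarith
    qed
    \<comment> \<open>Summing the codimensions of the \<open>D i\<close> turns the hypothesis on
      \<open>size M\<close> into the bound \<open>dim L\<close> on the total.\<close>
    have "int (\<Sum>i<m. dim (N i)) \<le> (\<Sum>i<m. int (dim L) + 1 - int (size (A i)))"
      unfolding of_nat_sum using dimN by (intro sum_mono) auto
    also have "\<dots> = int m * (int (dim L) + 1) - int (size M)"
    proof -
      have "(\<Sum>i<m. size (A i)) = size M"
        using A(1) by (simp add: proper_partition_def flip: size_multiset_sum)
      then show ?thesis by (simp add: sum_subtractf flip: of_nat_sum)
    qed
    also have "\<dots> < int (dim L) + 1"
    proof -
      have "int (dim L) = aff_dim (set_mset M)"
        unfolding L_def using \<open>M \<noteq> {#}\<close> by (intro dim_diff_span) simp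
      moreover have "int m * (int (dim L) + 1) = (int (dim L) + 1) * int (m - 1) + (int (dim L) + 1)"
        using \<open>0 < m\<close> by (cases m) (simp_all add: algebra_simps)
      ultimately show ?thesis using size by simp
    qed
    finally have dimNL: "(\<Sum>i<m. dim (N i)) \<le> dim L" by linarith
    have yK: "y i \<in> K" if "i < m" for i
      unfolding K_def using y(1)[OF that] hull_mono[OF set_mset_mono[OF proper_partition_subset[OF A(1)]]] by blast
    have nN: "X A - y i \<in> N i" if i: "i < m" for i
    proof -
      have "X A - y i \<in> L"
        unfolding L_def using X(1) yK[OF i] by (intro diff_in_diff_span) (auto simp: K_def)
      moreover have "D i \<subseteq> {w. orthogonal w (X A - y i)}"
        unfolding D_def diff_span_def
      proof (rule span_minimal)
        show "subspace {w. orthogonal w (X A - y i)}"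
          by (auto simp: subspace_def orthogonal_clauses)
        show "{v - w |v w. v \<in># A i \<and> w \<in># A i} \<subseteq> {w. orthogonal w (X A - y i)}"
        proof safe
          fix v w assume "v \<in># A i" "w \<in># A i"
          then have "(X A - y i) \<bullet> (v - y i) - (X A - y i) \<bullet> (w - y i) = 0"
            using y(5)[OF i] by simp
          then show "orthogonal (v - w) (X A - y i)"
            by (simp add: orthogonal_def inner_diff inner_commute)
        qed
      qed
      ultimately show ?thesis by (auto simp: N_def)
    qed
    have notL: "\<not> L \<subseteq> span (\<Union>i\<in>{..<m}. N i)"
    proof
      assume L: "L \<subseteq> span (\<Union>i\<in>{..<m}. N i)"
      have "(\<Sum>i<m. X A - y i) = 0"
        using \<open>0 < m\<close> by (subst y(3)) (simp add: sum_subtractf scaleR_right.sum[symmetric] sum_constant_scaleR)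
      then have "X A - y i = 0" if "i < m" for i
        using sum_zero_in_direct_sum[OF finite_lessThan sub(3) L dimNL, of "\<lambda>i. X A - y i" i] nN that
        by simp
      then have "part_energy m A (X A) = 0" unfolding y(2) by simp
      then show False using \<open>0 < g\<close> by (simp add: g_def)
    qed
    have NL: "span (\<Union>i\<in>{..<m}. N i) \<subseteq> L"
      using sub(1) by (intro span_minimal) (auto simp: N_def)
    have spans: "span L = L" "span (D i) = D i" for i
      using sub span_eq_iff by blast+
    have "span (\<Union>i\<in>{..<m}. N i) \<subset> span L"
      unfolding spans(1) using notL NL by blast
    then obtain u where u: "u \<noteq> 0" "u \<in> span L"
      "\<And>z. z \<in> span (\<Union>i\<in>{..<m}. N i) \<Longrightarrow> orthogonal u z"
      using orthogonal_to_subspace_exists_gen by blast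
    have "u \<in> L" using u(2) unfolding spans(1) .
    \<comment> \<open>The component \<open>q\<close> of \<open>u\<close> orthogonal to
      \<open>D i\<close> lies in \<open>N i\<close>, to which \<open>u\<close> is orthogonal, so
      \<open>q\<close> vanishes.\<close>
    have uD: "u \<in> D i" if i: "i < m" for i
    proof -
      obtain p q where pq: "p \<in> span (D i)" "\<And>w. w \<in> span (D i) \<Longrightarrow> orthogonal q w" "u = p + q"
        using orthogonal_subspace_decomp_exists by metis
      note pq = pq[unfolded spans(2)]
      have "p \<in> L" using pq(1) DL by blast
      then have "q \<in> L" using subspace_diff[OF sub(1) \<open>u \<in> L\<close>] pq(3) by fastforce
      then have "q \<in> N i" using pq(2) by (auto simp: N_def orthogonal_commute)
      then have "orthogonal u q" using i by (intro u(3) span_base) auto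
      moreover have "orthogonal q p" using pq(1,2) by blast
      ultimately have "q \<bullet> q = 0" using pq(3) by (simp add: orthogonal_def inner_add inner_commute)
      then show ?thesis using pq(1,3) by simp
    qed
    have "compact Z"
    proof -
      have "closed {x. part_energy m A x = g}"
        by (intro closed_Collect_eq continuous_part_energy continuous_on_const)
      then show ?thesis unfolding Z_def by (intro compact_Int_closed K)
    qed
    moreover have "Z \<noteq> {}" using \<open>X A \<in> Z\<close> by blast
    ultimately obtain x where x: "x \<in> Z" "\<And>z. z \<in> Z \<Longrightarrow> u \<bullet> z \<le> u \<bullet> x"
      using continuous_attains_sup[of Z "\<lambda>z. u \<bullet> z"]
        continuous_on_inner[OF continuous_on_const[of Z u] continuous_on_id] by blast
    obtain w where w: "\<And>i. i < m \<Longrightarrow> w i \<in> convex hull ?V i"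
      "part_energy m A x = (\<Sum>i<m. (dist x (w i))\<^sup>2)"
      "x = (\<Sum>i<m. (1 / m) *\<^sub>R w i)"
      "\<And>i v. \<lbrakk>i < m; v \<in># A i\<rbrakk> \<Longrightarrow> w i \<notin> convex hull (set_mset (A i - {#v#}))"
      using Z[OF x(1)] by metis
    have "\<exists>e>0. \<forall>t. \<bar>t\<bar> \<le> e \<longrightarrow> w i + t *\<^sub>R u \<in> convex hull ?V i" if i: "i < m" for i
      using minimal_hull_move[OF _ w(1)[OF i] minimal[OF w(4)[OF i]] uD[OF i, unfolded D_def]]
      by (metis finite_set_mset)
    then obtain e where e: "\<And>i. i < m \<Longrightarrow> 0 < e i"
      "\<And>i t. \<lbrakk>i < m; \<bar>t\<bar> \<le> e i\<rbrakk> \<Longrightarrow> w i + t *\<^sub>R u \<in> convex hull ?V i"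
      by metis
    obtain t where t: "0 < t" "\<And>i. i < m \<Longrightarrow> t \<le> e i"
      using ex_common_lower_bound[of "{..<m}" e] e(1) by auto
    have move: "w i + t *\<^sub>R u \<in> convex hull ?V i" if "i < m" for i
      using e(2)[OF that, of t] t that by simp
    have "x + t *\<^sub>R u = (\<Sum>i<m. (1 / m) *\<^sub>R (w i + t *\<^sub>R u))"
      using \<open>0 < m\<close> w(3) by (simp add: scaleR_add_right sum.distrib sum_constant_scaleR)
    also have "\<dots> \<in> K"
      unfolding K_def using \<open>0 < m\<close> move hull_mono[OF set_mset_mono[OF proper_partition_subset[OF A(1)]]]
      by (intro convex_sum) auto
    finally have inK: "x + t *\<^sub>R u \<in> K" .
    \<comment> \<open>Shifting \<open>x\<close> and all the nearest points by the same vector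
      preserves the distances.\<close>
    have "part_energy m A (x + t *\<^sub>R u) \<le> (\<Sum>i<m. (dist (x + t *\<^sub>R u) (w i + t *\<^sub>R u))\<^sup>2)"
      using move by (rule part_energy_le)
    also have "\<dots> = g" using w(2) x(1) by (simp add: Z_def)
    finally have "x + t *\<^sub>R u \<in> Z"
      using g_min[OF A(1) inK] inK by (simp add: Z_def)
    then have "t * (u \<bullet> u) \<le> 0" using x(2) by (fastforce simp: inner_add_right)
    moreover have "0 < u \<bullet> u" using u(1) by simp
    ultimately show False using t(1) by (simp add: mult_le_0_iff)
  qed
  have "X A \<in> convex hull (set_mset (A i))" if i: "i < m" for i
  proof -
    have "(infdist (X A) (convex hull (set_mset (A i))))\<^sup>2 = 0"
      using \<open>g = 0\<close> i unfolding g_def part_energy_def by (subst (asm) sum_nonneg_eq_0_iff) auto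
    moreover have "convex hull (set_mset (A i)) \<noteq> {}"
      using A(1) i by (simp add: proper_partition_def)
    ultimately show ?thesis
      using in_closed_iff_infdist_zero[OF compact_imp_closed[OF compact_hull_mset], of "A i"] by auto
  qed
  then have "X A \<in> (\<Inter>i<m. convex hull (set_mset (A i)))" by simp
  then show ?thesis
    using A(1) by (intro that[of A]) (auto simp only: proper_partition_def)
qed

section \<open>Helly number at most three\<close>

text \<open>At most \<open>h\<close> of the \<open>h + 1\<close> hulls leave some index
  \<open>i\<close> that none of them omits, and then \<open>f i\<close> lies in all of them.\<close>

lemma helly_prop_points:
  assumes "helly_prop S h" and f: "\<And>i. i \<le> h \<Longrightarrow> f i \<in> S"
  shows "(\<Inter>i\<le>h. convex hull (f ` ({..h} - {i}))) \<inter> S \<noteq> {}"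
proof (rule helly_prop_family[OF assms(1)])
  fix J assume J: "J \<subseteq> {..h}" "card J \<le> h"
  then have "J \<noteq> {..h}" by auto
  then obtain i where i: "i \<le> h" "i \<notin> J" using J(1) by blast
  have "f i \<in> convex hull (f ` ({..h} - {j}))" if "j \<in> J" for j
    using i that by (intro hull_inc) auto
  then show "(\<Inter>j\<in>J. convex hull (f ` ({..h} - {j}))) \<inter> S \<noteq> {}"
    using f[OF i(1)] by blast
qed auto

text \<open>Otherwise \<open>S\<close> contains \<open>h + 1\<close> affinely independent points,
  and the facets of their simplex have no common point, against
  \<open>helly_prop_points\<close>.\<close>

lemma helly_prop_aff_dim:
  assumes "helly_prop S h"
  shows "aff_dim S < int h"
proof (rule ccontr)
  assume "\<not> aff_dim S < int h"
  obtain B where B: "B \<subseteq> S" "\<not> affine_dependent B" "affine hull S = affine hull B"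
    using affine_basis_exists by blast
  have "int (card B) = aff_dim S + 1"
    using aff_dim_affine_independent[OF B(2)] B(3) by (metis aff_dim_affine_hull)
  then have "card {..h} \<le> card B" using \<open>\<not> aff_dim S < int h\<close> by simp
  then obtain f where f: "f ` {..h} \<subseteq> B" "inj_on f {..h}"
    using card_le_inj[of "{..h}" B] aff_independent_finite[OF B(2)] by auto
  let ?T = "(\<lambda>i. f ` ({..h} - {i})) ` {..h}"
  have "\<Union>?T \<subseteq> B" using f(1) by blast
  then have "convex hull \<Inter>?T = (\<Inter>T\<in>?T. convex hull T)"
    using B(2) affine_independent_subset by (intro convex_hull_Inter) blast
  moreover have "\<Inter>?T = {}"
  proof -
    have False if "x \<in> \<Inter>?T" for x
    proof -
      have "x \<in> f ` ({..h} - {0})" using that by blast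
      then obtain i where i: "i \<le> h" "x = f i" by blast
      then have "f i \<in> f ` ({..h} - {i})" using that by blast
      then show False using f(2) i(1) by (auto simp: inj_on_def)
    qed
    then show ?thesis by blast
  qed
  ultimately have "(\<Inter>T\<in>?T. convex hull T) = {}" by simp
  moreover have "f i \<in> S" if "i \<le> h" for i using f(1) B(1) that by auto
  ultimately show False
    using helly_prop_points[OF assms, of f] by simp
qed

text \<open>A weighted mean of \<open>c\<close> and \<open>d\<close> lies on the line through
  \<open>a\<close> and \<open>b\<close>, so the two triangles over \<open>{a, b}\<close> lie on
  opposite sides of it and can share only points of the line.\<close>

lemma inner_eq_from_triangles:
  fixes n :: "'a::real_inner"
  assumes "n \<bullet> a = r" "n \<bullet> b = r" and r: "s * (n \<bullet> c) + t * (n \<bullet> d) = r" "0 < s" "0 < t" "s + t = 1"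
    and "z \<in> convex hull {a, b, c}" "z \<in> convex hull {a, b, d}"
  shows "n \<bullet> z = r"
proof -
  have le: "n \<bullet> z \<le> r" if "n \<bullet> x \<le> r" "z \<in> convex hull {a, b, x}" for x
    using that assms(1,2) hull_minimal[of "{a, b, x}" "{y. n \<bullet> y \<le> r}" convex]
    by (auto simp: convex_halfspace_le)
  have ge: "n \<bullet> z \<ge> r" if "n \<bullet> x \<ge> r" "z \<in> convex hull {a, b, x}" for x
    using that assms(1,2) hull_minimal[of "{a, b, x}" "{y. n \<bullet> y \<ge> r}" convex]
    by (auto simp: convex_halfspace_ge)
  have "s * (n \<bullet> c - r) + t * (n \<bullet> d - r) = s * (n \<bullet> c) + t * (n \<bullet> d) - (s + t) * r"
    by (simp add: algebra_simps)
  then have "s * (n \<bullet> c - r) = - (t * (n \<bullet> d - r))"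
    using r(1,4) by simp
  then have "n \<bullet> c \<le> r \<and> n \<bullet> d \<ge> r \<or> n \<bullet> c \<ge> r \<and> n \<bullet> d \<le> r"
    using r(2,3) by (smt (verit) mult_pos_pos mult_pos_neg)
  then show ?thesis
    using le ge assms(7,8) by (meson antisym)
qed

text \<open>Applied to the four triangles spanned by the end points, the Helly property gives a
  common point in \<open>S\<close>. It must lie on both crossing lines, hence equals
  \<open>e\<close>.\<close>

lemma helly_prop_3_crossing:
  fixes a b c d :: pt
  assumes helly: "helly_prop S 3" and S: "a \<in> S" "b \<in> S" "c \<in> S" "d \<in> S"
    and s: "0 < s1" "0 < s2" "s1 + s2 = 1" "e = s1 *\<^sub>R a + s2 *\<^sub>R b"
    and t: "0 < t1" "0 < t2" "t1 + t2 = 1" "e = t1 *\<^sub>R c + t2 *\<^sub>R d"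
    and "b - a \<notin> span {d - c}" "c \<noteq> d"
  shows "e \<in> S"
proof -
  define f where "f i = [a, b, c, d] ! i" for i
  have "f i \<in> S" if "i \<le> 3" for i
    using S that by (auto simp: f_def less_Suc_eq numeral_3_eq_3 le_Suc_eq)
  then obtain z where z: "z \<in> S" "\<And>i. i \<le> 3 \<Longrightarrow> z \<in> convex hull (f ` ({..3} - {i}))"
    using helly_prop_points[OF helly, of f] by blast
  have sets: "{..3} - {0} = {1, 2, 3::nat}" "{..3} - {1} = {0, 2, 3::nat}"
    "{..3} - {2} = {0, 1, 3::nat}" "{..3} - {3} = {0, 1, 2::nat}" by auto
  have hulls: "z \<in> convex hull {a, b, c}" "z \<in> convex hull {a, b, d}"
    "z \<in> convex hull {c, d, a}" "z \<in> convex hull {c, d, b}"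
    using z(2)[of 3] z(2)[of 2] z(2)[of 1] z(2)[of 0] unfolding sets
    by (simp_all add: f_def insert_commute)
  define p q where "p = b - a" and "q = d - c"
  \<comment> \<open>Normals of the two lines, obtained by turning their directions by a right
    angle.\<close>
  define n n' :: pt where "n = vector [- p $ 2, p $ 1]" and "n' = vector [- q $ 2, q $ 1]"
  have n: "n \<bullet> v = p $ 1 * v $ 2 - p $ 2 * v $ 1" and n': "n' \<bullet> v = q $ 1 * v $ 2 - q $ 2 * v $ 1" for v
    by (simp_all add: inner_pt n_def n'_def)
  have "n \<bullet> (b - a) = 0" "n' \<bullet> (d - c) = 0"
    unfolding n n' p_def q_def by simp_all
  then have nab: "n \<bullet> a = n \<bullet> b" "n' \<bullet> c = n' \<bullet> d"
    by (simp_all add: inner_diff_right)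
  have nb: "n \<bullet> e = n \<bullet> b"
    unfolding s(4) using nab s(3) by (simp add: inner_add_right flip: distrib_right)
  have nd: "n' \<bullet> e = n' \<bullet> d"
    unfolding t(4) using nab t(3) by (simp add: inner_add_right flip: distrib_right)
  have "n \<bullet> z = n \<bullet> e"
  proof (rule inner_eq_from_triangles)
    show "n \<bullet> a = n \<bullet> e" "n \<bullet> b = n \<bullet> e" using nab nb by simp_all
    show "t1 * (n \<bullet> c) + t2 * (n \<bullet> d) = n \<bullet> e" by (simp add: t(4) inner_add_right)
  qed (use hulls t in auto)
  moreover have "n' \<bullet> z = n' \<bullet> e"
  proof (rule inner_eq_from_triangles)
    show "n' \<bullet> c = n' \<bullet> e" "n' \<bullet> d = n' \<bullet> e" using nab nd by simp_all
    show "s1 * (n' \<bullet> a) + s2 * (n' \<bullet> b) = n' \<bullet> e" by (simp add: s(4) inner_add_right)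
  qed (use hulls s in auto)
  ultimately have "n \<bullet> (z - e) = 0" "n' \<bullet> (z - e) = 0"
    by (simp_all add: inner_diff_right)
  then have pe: "p $ 1 * (z - e) $ 2 = p $ 2 * (z - e) $ 1" and qe: "q $ 1 * (z - e) $ 2 = q $ 2 * (z - e) $ 1"
    unfolding n n' by simp_all
  \<comment> \<open>The determinant of the two linear equations for \<open>z - e\<close>; it
    vanishes only for parallel lines.\<close>
  have "p $ 1 * q $ 2 \<noteq> p $ 2 * q $ 1"
  proof
    assume par: "p $ 1 * q $ 2 = p $ 2 * q $ 1"
    have "(q \<bullet> q) *\<^sub>R p = (p \<bullet> q) *\<^sub>R q"
      using par by (simp add: vec_eq_iff forall_2 inner_pt algebra_simps)
    moreover have "q \<bullet> q \<noteq> 0" using assms(15) by (simp add: q_def)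
    ultimately have "p = inverse (q \<bullet> q) *\<^sub>R (p \<bullet> q) *\<^sub>R q"
      by (metis left_inverse scaleR_one scaleR_scaleR)
    also have "\<dots> \<in> span {q}" by (intro span_scale span_base) simp
    finally have "p \<in> span {q}" .
    then show False using assms(14) by (simp add: p_def q_def)
  qed
  moreover have "(p $ 1 * q $ 2 - p $ 2 * q $ 1) * (z - e) $ 1 = 0"
    "(p $ 1 * q $ 2 - p $ 2 * q $ 1) * (z - e) $ 2 = 0"
    using pe qe by algebra+
  ultimately have "(z - e) $ 1 = 0" "(z - e) $ 2 = 0" by simp_all
  then have "z = e" by (simp add: vec_eq_iff forall_2)
  then show ?thesis using z(1) by simp
qed

lemma minimal_hull_subset:
  assumes "finite V" "e \<in> convex hull V"
  obtains B where "B \<subseteq> V" "e \<in> convex hull B" "\<And>v. v \<in> B \<Longrightarrow> e \<notin> convex hull (B - {v})"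
proof -
  let ?\<B> = "{B. B \<subseteq> V \<and> e \<in> convex hull B}"
  have "finite ?\<B>" using assms(1) by auto
  moreover have "V \<in> ?\<B>" using assms(2) by auto
  ultimately have "\<exists>B\<in>?\<B>. B \<subseteq> V \<and> (\<forall>C\<in>?\<B>. C \<subseteq> B \<longrightarrow> B = C)"
    by (rule finite_has_minimal2)
  then obtain B where B: "B \<subseteq> V" "e \<in> convex hull B" "\<And>C. \<lbrakk>C \<subseteq> V; e \<in> convex hull C; C \<subseteq> B\<rbrakk> \<Longrightarrow> B = C"
    by auto
  show ?thesis
  proof (rule that[OF B(1,2)])
    fix v assume "v \<in> B"
    then show "e \<notin> convex hull (B - {v})" using B(3)[of "B - {v}"] B(1) by blast
  qed
qed

text \<open>By minimality \<open>e\<close> can be moved both ways along \<open>u\<close> inside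
  every hull, so a nonzero \<open>u\<close> would put it in the middle of a segment of the
  intersection.\<close>

lemma extreme_point_of_Inter_hulls:
  fixes V :: "'i \<Rightarrow> 'a::euclidean_space set"
  assumes e: "e extreme_point_of (\<Inter>i\<in>I. convex hull (V i))"
    and I: "finite I" and V: "\<And>i. i \<in> I \<Longrightarrow> finite (V i)" "\<And>i. i \<in> I \<Longrightarrow> e \<in> convex hull (V i)"
    "\<And>i v. \<lbrakk>i \<in> I; v \<in> V i\<rbrakk> \<Longrightarrow> e \<notin> convex hull (V i - {v})"
    and u: "\<And>i. i \<in> I \<Longrightarrow> u \<in> diff_span (V i)"
  shows "u = 0"
proof (rule ccontr)
  assume "u \<noteq> 0"
  have "\<exists>r>0. \<forall>t. \<bar>t\<bar> \<le> r \<longrightarrow> e + t *\<^sub>R u \<in> convex hull (V i)" if "i \<in> I" for i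
    using minimal_hull_move[OF V(1,2,3)[OF that] u[OF that]] that by metis
  then obtain r where r: "\<And>i. i \<in> I \<Longrightarrow> 0 < r i"
    "\<And>i t. \<lbrakk>i \<in> I; \<bar>t\<bar> \<le> r i\<rbrakk> \<Longrightarrow> e + t *\<^sub>R u \<in> convex hull (V i)"
    by metis
  obtain t where t: "0 < t" "\<And>i. i \<in> I \<Longrightarrow> t \<le> r i"
    using ex_common_lower_bound[OF I, of r] r(1) by auto
  have "e + t *\<^sub>R u \<in> (\<Inter>i\<in>I. convex hull (V i))" "e + (- t) *\<^sub>R u \<in> (\<Inter>i\<in>I. convex hull (V i))"
    using r(2)[of _ t] r(2)[of _ "- t"] t by auto
  moreover have "e \<in> open_segment (e + t *\<^sub>R u) (e + (- t) *\<^sub>R u)"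
    unfolding in_segment using t(1) \<open>u \<noteq> 0\<close>
    by (auto intro!: exI[of _ "1/2"] simp: algebra_simps scaleR_left_distrib[symmetric] eq_neg_iff_add_eq_0)
  ultimately show False using e unfolding extreme_point_of_def by blast
qed

text \<open>An extreme point \<open>e\<close> of the intersection lies in \<open>S\<close>. With
  minimal carrying sets \<open>B i\<close>, either one of them is \<open>{e}\<close>, or two of them
  are nonparallel segments crossing at \<open>e\<close>.\<close>

lemma Inter_hulls_meets_crossing_closed:
  assumes helly: "helly_prop S 3" and I: "finite I" "I \<noteq> {}"
    and V: "\<And>i. i \<in> I \<Longrightarrow> finite (V i)" "\<And>i. i \<in> I \<Longrightarrow> V i \<subseteq> S"
    and ne: "(\<Inter>i\<in>I. convex hull (V i)) \<noteq> {}"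
  shows "(\<Inter>i\<in>I. convex hull (V i)) \<inter> S \<noteq> {}"
proof -
  let ?K = "\<Inter>i\<in>I. convex hull (V i)"
  have "compact ?K"
    using I(2) V(1) by (intro compact_Inter) (auto simp: finite_imp_compact_convex_hull)
  moreover have "convex ?K" by (intro convex_INT) auto
  ultimately obtain e where e: "e extreme_point_of ?K"
    using extreme_point_exists_convex ne by blast
  then have eK: "e \<in> ?K" by (simp add: extreme_point_of_def)
  have "\<exists>B\<subseteq>V i. e \<in> convex hull B \<and> (\<forall>v\<in>B. e \<notin> convex hull (B - {v}))" if "i \<in> I" for i
    using minimal_hull_subset[OF V(1)[OF that], of e] eK that by (metis INT_E)
  then obtain B where B: "\<And>i. i \<in> I \<Longrightarrow> B i \<subseteq> V i" "\<And>i. i \<in> I \<Longrightarrow> e \<in> convex hull (B i)"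
    "\<And>i v. \<lbrakk>i \<in> I; v \<in> B i\<rbrakk> \<Longrightarrow> e \<notin> convex hull (B i - {v})"
    by metis
  have fin: "finite (B i)" if "i \<in> I" for i
    using B(1) V(1) that finite_subset by blast
  have BK: "(\<Inter>i\<in>I. convex hull (B i)) \<subseteq> ?K"
    using B(1) by (intro INT_anti_mono hull_mono) auto
  have ext: "e extreme_point_of (\<Inter>i\<in>I. convex hull (B i))"
    using e BK B(2) unfolding extreme_point_of_def by blast
  have zero: "u = 0" if "\<And>i. i \<in> I \<Longrightarrow> u \<in> diff_span (B i)" for u
    using ext I(1) fin B(2,3) that by (rule extreme_point_of_Inter_hulls)
  have "e \<in> S"
  proof (cases "\<exists>i\<in>I. card (B i) = 1")
    case True
    then obtain i b where "i \<in> I" "B i = {b}" by (metis card_1_singletonE)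
    then show ?thesis using B(1,2)[of i] V(2)[of i] by auto
  next
    case False
    have segment: "\<exists>a b. B i = {a, b} \<and> a \<noteq> b" if i: "i \<in> I" "v \<notin> diff_span (B i)" for i v
    proof -
      have "diff_span (B i) \<noteq> UNIV" using i(2) by blast
      moreover have "span (diff_span (B i)) = diff_span (B i)"
        using span_eq_iff subspace_diff_span by blast
      ultimately have "span (diff_span (B i)) \<noteq> UNIV" by argo
      then have "dim (diff_span (B i)) \<noteq> 2"
        using dim_eq_full[of "diff_span (B i)"] by simp
      then have "dim (diff_span (B i)) < 2"
        using dim_subset_UNIV[of "diff_span (B i)"] by simp
      moreover have "int (card (B i)) \<le> int (dim (diff_span (B i))) + 1"
        using minimal_hull_card[OF fin[OF i(1)] B(2,3)[OF i(1)]] by blast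
      moreover have "card (B i) \<noteq> 0" using B(2)[OF i(1)] fin[OF i(1)] by auto
      ultimately have "card (B i) = 2" using False i(1) by force
      then show ?thesis by (meson card_2_iff)
    qed
    \<comment> \<open>Any nonzero vector serves here: some \<open>B i\<close> misses it, so it does
      not span the plane and is a segment. The direction of that segment is in turn missed by
      another \<open>B j\<close>.\<close>
    have "axis 1 1 \<noteq> (0 :: pt)" by (simp add: axis_eq_0_iff)
    then obtain i where i: "i \<in> I" "axis 1 1 \<notin> diff_span (B i)" using zero by blast
    then obtain a b where ab: "B i = {a, b}" "a \<noteq> b" using segment by blast
    have "b - a \<noteq> 0" using ab by simp
    then obtain j where j: "j \<in> I" "b - a \<notin> diff_span (B j)" using zero by blast
    then obtain c d where cd: "B j = {c, d}" "c \<noteq> d" using segment by blast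
    have "span {d - c} \<subseteq> diff_span (B j)"
      unfolding diff_span_def cd by (intro span_mono) auto
    then have par: "b - a \<notin> span {d - c}" using j(2) by blast
    obtain s where s: "\<And>v. v \<in> B i \<Longrightarrow> 0 < s v" "sum s (B i) = 1" "(\<Sum>v\<in>B i. s v *\<^sub>R v) = e"
      using minimal_hull_coeffs[OF fin B(2,3)] i(1) by metis
    obtain t where t: "\<And>v. v \<in> B j \<Longrightarrow> 0 < t v" "sum t (B j) = 1" "(\<Sum>v\<in>B j. t v *\<^sub>R v) = e"
      using minimal_hull_coeffs[OF fin B(2,3)] j(1) by metis
    have "B i \<subseteq> S" "B j \<subseteq> S" using B(1) V(2) i(1) j(1) by blast+
    then show ?thesis
      using s t ab cd par
      by (intro helly_prop_3_crossing[OF helly, of a b c d "s a" "s b" e "t c" "t d"]) auto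
  qed
  then show ?thesis using eK by blast
qed

text \<open>As \<open>aff_dim S \<le> h - 1\<close>, Tverberg's theorem in the affine hull needs
  only this many points. For \<open>h < 3\<close> the crossing argument applies by monotonicity of
  the Helly property.\<close>

lemma tv_prop_small:
  assumes helly: "helly_prop S h" and h: "0 < h" "h \<le> 3" and m: "0 < m"
  shows "tv_prop S m (h * (m - 1) + 1)"
  unfolding tv_prop_def
proof (intro allI impI)
  fix M :: "pt multiset" assume M: "size M = h * (m - 1) + 1" "set_mset M \<subseteq> S"
  have "aff_dim (set_mset M) + 1 \<le> int h"
    using helly_prop_aff_dim[OF helly] aff_dim_subset[OF M(2)] by linarith
  then have "(aff_dim (set_mset M) + 1) * int (m - 1) \<le> int h * int (m - 1)"
    by (intro mult_right_mono) auto
  then have "(aff_dim (set_mset M) + 1) * int (m - 1) < int (size M)"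
    using M(1) by simp
  then obtain A where A: "(\<Sum>i<m. A i) = M" "(\<Inter>i<m. convex hull (set_mset (A i))) \<noteq> {}"
    using tverberg_aff_dim[OF m] by blast
  have "set_mset (A i) \<subseteq> S" if "i < m" for i
  proof -
    have "A i \<subseteq># M"
      unfolding A(1)[symmetric] using that by (subst sum.remove[of _ i]) auto
    then show ?thesis using M(2) set_mset_mono by blast
  qed
  then have "(\<Inter>i<m. convex hull (set_mset (A i))) \<inter> S \<noteq> {}"
    using m A(2) by (intro Inter_hulls_meets_crossing_closed helly_prop_mono[OF helly h(2)]) auto
  then show "tverberg_partitionable S m M"
    unfolding tverberg_partitionable_def using A(1) by blast
qed

section \<open>The two bounds and the extremal examples\<close>

text \<open>The witness may have more than \<open>h\<close> points, which is harmless because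
  \<open>tv_prop\<close> is monotone in the number of points.\<close>

lemma Tv_He_lower:
  assumes "He S = enat h" "S \<noteq> {}" "0 < m"
  shows "enat (h * (m - 1) + 1) \<le> Tv S m"
proof (rule Tv_ge[OF _ assms(3)])
  obtain X where X: "finite X" "X \<subseteq> S" "h - 1 < card X" "(\<Inter>x\<in>X. convex hull (X - {x})) \<inter> S = {}"
    using not_helly_prop_witness[OF He_enatD(3)[OF assms(1,2)]] by blast
  then have "h * (m - 1) \<le> card X * (m - 1)" by (intro mult_right_mono) auto
  then show "\<not> tv_prop S m (h * (m - 1))"
    using not_tv_prop[OF X(1,2,4) assms(3)] tv_prop_mono assms(3) by blast
qed

lemma Tv_eq:
  assumes "He S = enat h" "S \<noteq> {}" "0 < m" "tv_prop S m (h * (m - 1) + 1)"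
  shows "Tv S m = He S * enat (m - 1) + 1"
proof -
  have "Tv S m = enat (h * (m - 1) + 1)"
    using Tv_le[OF assms(4)] Tv_He_lower[OF assms(1-3)] by (intro antisym) auto
  then show ?thesis by (simp add: assms(1) one_enat_def)
qed

text \<open>If the Helly number were at most 3, \<open>tv_prop_small\<close> would split any four
  points; thus the Tverberg side supplies the lower bound.\<close>

lemma He_4I:
  assumes "helly_prop S 4" "S \<noteq> {}" "\<not> tv_prop S 2 4"
  shows "He S = 4"
proof -
  obtain h where h: "He S = enat h" "h \<le> 4"
    using He_le[OF assms(1)] by (cases "He S") auto
  have "\<not> h \<le> 3"
  proof
    assume "h \<le> 3"
    then have "tv_prop S 2 (h * (2 - 1) + 1)"
      using He_enatD[OF h(1) assms(2)] by (intro tv_prop_small) auto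
    then show False using assms(3) tv_prop_mono[of S 2 "h + 1" 4] \<open>h \<le> 3\<close> by simp
  qed
  then have "h = 4" using h(2) by simp
  then show ?thesis using h(1) by (simp add: numeral_eq_enat)
qed

section \<open>Finite examples with Helly number four\<close>

lemma finite_imp_discrete_set: "finite S \<Longrightarrow> discrete_set S"
  by (simp add: discrete_set_def)

lemma notin_convex_hull_of_inner_less:
  fixes v :: "'a::real_inner"
  assumes "\<And>w. w \<in> W \<Longrightarrow> v \<bullet> w < v \<bullet> v"
  shows "v \<notin> convex hull W"
proof -
  have "convex hull W \<subseteq> {w. v \<bullet> w < v \<bullet> v}"
    using assms by (intro hull_minimal convex_halfspace_lt) auto
  then show ?thesis by blast
qed

text \<open>The vertices of a square. Each is outside the hull of the others, so the four have no
  partition; among five points one repeats, and two copies of it serve as the parts.\<close>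

lemma ex_He_4_Tv_2_eq_5:
  "\<exists>S. discrete_set S \<and> S \<noteq> {} \<and> He S = 4 \<and> Tv S 2 = 5"
proof -
  define S :: "pt set" where "S = {vector [1, 0], vector [0, 1], vector [-1, 0], vector [0, -1]}"
  have fin: "finite S" "S \<noteq> {}" by (simp_all add: S_def)
  have card: "card S = 4"
    by (simp add: S_def vec_eq_iff forall_2)
  have "v \<notin> convex hull (S - {v})" if "v \<in> S" for v
    using that by (intro notin_convex_hull_of_inner_less) (auto simp: S_def inner_pt)
  then have "(\<Inter>x\<in>S. convex hull (S - {x})) \<inter> S = {}" by blast
  then have not4: "\<not> tv_prop S 2 4"
    using not_tv_prop[OF fin(1) order_refl, of 2] card by simp
  have helly: "helly_prop S 4"
  proof (rule ccontr)
    assume "\<not> helly_prop S 4"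
    then obtain X where "finite X" "X \<subseteq> S" "4 < card X" by (rule not_helly_prop_witness)
    then show False using card_mono[OF fin(1), of X] card by simp
  qed
  have "tv_prop S 2 5"
    unfolding tv_prop_def
  proof (intro allI impI)
    fix M :: "pt multiset" assume M: "size M = 5" "set_mset M \<subseteq> S"
    have "\<exists>x. 2 \<le> count M x"
    proof (rule ccontr)
      assume "\<not> ?thesis"
      then have "\<And>x. count M x \<le> 1" by (metis not_less_eq_eq one_add_one plus_1_eq_Suc)
      then have "size M \<le> (\<Sum>x\<in>set_mset M. 1)"
        unfolding size_multiset_overloaded_eq by (intro sum_mono) auto
      also have "\<dots> \<le> 4" using card_mono[OF fin(1) M(2)] card by simp
      finally show False using M(1) by simp
    qed
    then obtain x where x: "2 \<le> count M x" by blast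
    show "tverberg_partitionable S 2 M"
    proof (rule tverberg_partitionableI[of 2 "\<lambda>_. {#x#}" M x])
      show "(\<Sum>i<2::nat. {#x#}) \<subseteq># M"
        using x by (simp add: numeral_2_eq_2 subseteq_mset_def)
      show "x \<in> S" using x M(2) by (metis count_eq_zero_iff not_numeral_le_zero subsetD)
    qed auto
  qed
  then have "Tv S 2 = 5"
    using Tv_le[of S 2 5] Tv_ge[OF not4] by (simp add: numeral_eq_enat)
  then show ?thesis
    using He_4I[OF helly fin(2) not4] fin finite_imp_discrete_set by blast
qed

text \<open>
  A pentagon inscribed in a circle together with the centre: the centre lies in the hull of any four
  vertices, but no two vertices are antipodal, so it lies in no edge or diagonal.
\<close>

lemma ex_He_4_Tv_2_ge_6:
  "\<exists>S. discrete_set S \<and> S \<noteq> {} \<and> He S = 4 \<and> 6 \<le> Tv S 2"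
proof -
  define V :: "pt set" where
    "V = {vector [5, 0], vector [3, 4], vector [-4, 3], vector [-4, -3], vector [3, -4]}"
  define S where "S = insert 0 V"
  have fin: "finite V" "finite S" "S \<noteq> {}" by (simp_all add: V_def S_def)
  have card: "card V = 5"
    by (simp add: V_def vec_eq_iff forall_2)
  have "0 \<notin> V" by (simp add: V_def vec_eq_iff forall_2)
  have norm: "v \<bullet> v = 25" if "v \<in> V" for v
    using that by (auto simp: V_def inner_pt)
  have inner: "- 25 < v \<bullet> w" "v \<noteq> w \<Longrightarrow> v \<bullet> w < 25" if "v \<in> V" "w \<in> V" for v w
    using that by (auto simp: V_def inner_pt)
  have extreme: "v \<notin> convex hull (V - {v})" if "v \<in> V" for v
    using that inner norm by (intro notin_convex_hull_of_inner_less) auto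
  have center: "0 \<in> convex hull (V - {v})" if "v \<in> V" for v
  proof -
    \<comment> \<open>Three triangles around the centre such that each vertex is avoided by at least
      one of them.\<close>
    have "0 \<in> convex hull {vector [5, 0], vector [-4, 3], vector [-4, -3 :: real] :: pt}"
      unfolding convex_hull_3 mem_Collect_eq
      by (rule exI[of _ "8/18"], rule exI[of _ "5/18"], rule exI[of _ "5/18"])
        (simp add: vec_eq_iff forall_2)
    moreover have "0 \<in> convex hull {vector [3, 4], vector [-4, -3], vector [3, -4 :: real] :: pt}"
      unfolding convex_hull_3 mem_Collect_eq
      by (rule exI[of _ "25/56"], rule exI[of _ "24/56"], rule exI[of _ "7/56"])
        (simp add: vec_eq_iff forall_2)
    moreover have "0 \<in> convex hull {vector [3, -4], vector [-4, 3], vector [3, 4 :: real] :: pt}"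
      unfolding convex_hull_3 mem_Collect_eq
      by (rule exI[of _ "25/56"], rule exI[of _ "24/56"], rule exI[of _ "7/56"])
        (simp add: vec_eq_iff forall_2)
    moreover have "{vector [5, 0], vector [-4, 3], vector [-4, -3]} \<subseteq> V - {v} \<or>
      {vector [3, 4], vector [-4, -3], vector [3, -4]} \<subseteq> V - {v} \<or>
      {vector [3, -4], vector [-4, 3], vector [3, 4]} \<subseteq> V - {v}"
      using that by (auto simp: V_def vec_eq_iff forall_2)
    ultimately show ?thesis by (meson hull_mono subsetD)
  qed
  have helly: "helly_prop S 4"
  proof (rule ccontr)
    assume "\<not> helly_prop S 4"
    then obtain X where X: "finite X" "X \<subseteq> S" "4 < card X" "(\<Inter>x\<in>X. convex hull (X - {x})) \<inter> S = {}"
      by (rule not_helly_prop_witness)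
    \<comment> \<open>Either the centre is among the remaining points, or these include at least
      four of the five vertices.\<close>
    have "0 \<in> convex hull (X - {x})" if "x \<in> X" for x
    proof (cases "0 \<in> X - {x}")
      case True
      then show ?thesis by (rule hull_inc)
    next
      case False
      then have sub: "X - {x} \<subseteq> V" using X(2) by (auto simp: S_def)
      have "card (V - (X - {x})) \<le> 1"
        using card_Diff_subset[OF _ sub] X(1,3) that card by simp
      moreover have "vector [5, 0] \<in> V" by (simp add: V_def)
      ultimately obtain v where "v \<in> V" "V - (X - {x}) \<subseteq> {v}"
        using subset_singleton_of_card_le_1[of "V - (X - {x})" V] fin(1) by blast
      then have "V - {v} \<subseteq> X - {x}" by blast
      then show ?thesis using center[OF \<open>v \<in> V\<close>] hull_mono by blast
    qed
    then show False using X(4) by (auto simp: S_def)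
  qed
  have not5: "\<not> tv_prop S 2 5"
  proof
    assume "tv_prop S 2 5"
    then have "tverberg_partitionable S 2 (mset_set V)"
      unfolding tv_prop_def S_def using fin(1) card by (auto elim: allE[of _ "mset_set V"])
    then obtain A :: "nat \<Rightarrow> pt multiset" and p where A: "(\<Sum>i<2. A i) = mset_set V" and p: "p \<in> S"
      "\<And>i. i < 2 \<Longrightarrow> p \<in> convex hull (set_mset (A i))"
      unfolding tverberg_partitionable_def by blast
    have sum: "A 0 + A 1 = mset_set V" using A by (simp add: numeral_2_eq_2)
    have "set_mset (A 0 + A 1) = V" unfolding sum using fin(1) by simp
    then have sub: "set_mset (A i) \<subseteq> V" if "i < 2" for i
      using that by (auto simp: less_2_cases_iff)
    show False
    proof (cases "p \<in> V")
      case True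
      \<comment> \<open>A vertex is outside the hull of the others, so it would be needed in both
        parts but occurs only once.\<close>
      have "p \<in># A i" if "i < 2" for i
      proof (rule ccontr)
        assume "p \<notin># A i"
        then have "set_mset (A i) \<subseteq> V - {p}" using sub[OF that] by blast
        then show False using extreme[OF True] p(2)[OF that] hull_mono[of _ "V - {p}" convex] by blast
      qed
      from this[of 0] this[of 1] have "2 \<le> count (A 0 + A 1) p"
        by (simp add: Suc_le_eq flip: count_greater_zero_iff)
      then show False unfolding sum using fin(1) by (simp add: count_mset_set' split: if_splits)
    next
      case False
      then have "p = 0" using p(1) by (simp add: S_def)
      \<comment> \<open>One of the two parts has at most two points, so its hull is a segment or a
        vertex and misses the centre.\<close>
      have "size (A 0 + A 1) = 5" unfolding sum using card by simp
      then have "size (A 0) \<le> 2 \<or> size (A 1) \<le> 2" unfolding size_union by linarith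
      then have "\<exists>i<2. size (A i) \<le> 2"
        by (auto intro: exI[of _ 0] exI[of _ 1])
      then obtain i where i: "i < 2" "size (A i) \<le> 2" by blast
      obtain v where v: "v \<in># A i" using p(2)[OF i(1)] by fastforce
      have card2: "card (set_mset (A i)) \<le> 2"
      proof -
        have "card (set_mset (A i)) = (\<Sum>x\<in>set_mset (A i). 1)" by simp
        also have "\<dots> \<le> size (A i)"
          unfolding size_multiset_overloaded_eq by (intro sum_mono) (simp add: Suc_le_eq)
        finally show ?thesis using i(2) by simp
      qed
      have "card (set_mset (A i) - {v}) \<le> 1" using card2 v by simp
      then obtain w where "w \<in># A i" "set_mset (A i) - {v} \<subseteq> {w}"
        using subset_singleton_of_card_le_1[of "set_mset (A i) - {v}" "set_mset (A i)"] v by blast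
      then have vw: "set_mset (A i) = {v, w}" using v by blast
      then have "v \<in> V" "w \<in> V" using sub[OF i(1)] by auto
      \<comment> \<open>\<open>v + w\<close> has positive inner product with both end points, since
        \<open>v \<bullet> v = w \<bullet> w = 25\<close> and
        \<open>v \<bullet> w > - 25\<close>.\<close>
      then have "convex hull {v, w} \<subseteq> {z. (v + w) \<bullet> z > 0}"
        using inner(1)[of v w] inner(1)[of w v] norm
        by (intro hull_minimal convex_halfspace_gt) (auto simp: inner_add_left)
      then show False using p(2)[OF i(1)] vw \<open>p = 0\<close> by auto
    qed
  qed
  then have "\<not> tv_prop S 2 4" using tv_prop_mono[of S 2 4 5] by auto
  then have "He S = 4" using He_4I[OF helly fin(3)] by blast
  moreover have "6 \<le> Tv S 2" using Tv_ge[OF not5] by (simp add: numeral_eq_enat)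
  ultimately show ?thesis using fin finite_imp_discrete_set by blast
qed

theorem theorem1:
  "(\<forall>S. discrete_set S \<and> S \<noteq> {} \<and> He S \<noteq> \<infinity> \<longrightarrow>
      (\<forall>m::nat. m \<ge> 3 \<longrightarrow> Tv S m = He S * enat (m - 1) + 1)
    \<and> (He S \<le> 3 \<longrightarrow> Tv S 2 = He S + 1)
    \<and> (He S \<ge> 4 \<longrightarrow> He S + 1 \<le> Tv S 2 \<and> Tv S 2 \<le> He S + 2))
   \<and> (\<exists>S. discrete_set S \<and> S \<noteq> {} \<and> He S \<noteq> \<infinity> \<and> He S \<ge> 4 \<and> Tv S 2 = He S + 1)
   \<and> (\<exists>S. discrete_set S \<and> S \<noteq> {} \<and> He S \<noteq> \<infinity> \<and> He S \<ge> 4 \<and> Tv S 2 = He S + 2)"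
proof -
  have main: "(\<forall>m\<ge>3. Tv S m = He S * enat (m - 1) + 1) \<and> (He S \<le> 3 \<longrightarrow> Tv S 2 = He S + 1) \<and>
      (He S \<ge> 4 \<longrightarrow> He S + 1 \<le> Tv S 2 \<and> Tv S 2 \<le> He S + 2)"
    if ne: "S \<noteq> {}" and fin: "He S \<noteq> \<infinity>" for S
  proof -
    obtain h where h: "He S = enat h" using fin by auto
    note helly = He_enatD[OF h ne]
    have "Tv S m = He S * enat (m - 1) + 1" if m: "m \<ge> 3" for m
    proof (rule Tv_eq[OF h ne])
      show "tv_prop S m (h * (m - 1) + 1)"
      proof (cases "h \<le> 3")
        case True
        then show ?thesis using helly m by (intro tv_prop_small) auto
      next
        case False
        then have "4 * (m - 1) \<le> h * (m - 1)" by (intro mult_right_mono) auto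
        \<comment> \<open>\<open>4 * (m - 1) + 1 \<ge> 3 * m\<close> holds from \<open>m = 3\<close>
          on and fails for \<open>m = 2\<close>.\<close>
        then have "3 * m \<le> h * (m - 1) + 1" using m by linarith
        then show ?thesis using m by (intro tv_prop_large[OF helly(2)]) auto
      qed
    qed (use m in auto)
    moreover have "Tv S 2 = He S + 1" if "He S \<le> 3"
    proof -
      have "tv_prop S 2 (h * (2 - 1) + 1)"
        using that helly by (intro tv_prop_small) (auto simp: h numeral_eq_enat)
      then show ?thesis using Tv_eq[OF h ne, of 2] by (simp add: h one_enat_def)
    qed
    moreover have "He S + 1 \<le> Tv S 2" "Tv S 2 \<le> He S + 2" if "He S \<ge> 4"
    proof -
      show "He S + 1 \<le> Tv S 2"
        using Tv_He_lower[OF h ne, of 2] by (simp add: h one_enat_def)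
      \<comment> \<open>With \<open>m = 2\<close> Birch's argument asks for \<open>3 * 2\<close>
        points, which for \<open>h = 4\<close> is \<open>h + 2\<close>.\<close>
      have "tv_prop S 2 (h + 2)"
        using that helly by (intro tv_prop_large[of S h]) (auto simp: h numeral_eq_enat)
      then show "Tv S 2 \<le> He S + 2"
        using Tv_le[of S 2 "h + 2"] by (simp add: h numeral_eq_enat)
    qed
    ultimately show ?thesis by blast
  qed
  moreover have "\<exists>S. discrete_set S \<and> S \<noteq> {} \<and> He S \<noteq> \<infinity> \<and> He S \<ge> 4 \<and> Tv S 2 = He S + 1"
  proof -
    obtain S where S: "discrete_set S" "S \<noteq> {}" "He S = 4" "Tv S 2 = 5"
      using ex_He_4_Tv_2_eq_5 by blast
    then have "Tv S 2 = He S + 1" by (simp add: numeral_eq_enat one_enat_def)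
    then show ?thesis using S by (intro exI[of _ S]) auto
  qed
  moreover have "\<exists>S. discrete_set S \<and> S \<noteq> {} \<and> He S \<noteq> \<infinity> \<and> He S \<ge> 4 \<and> Tv S 2 = He S + 2"
  proof -
    obtain S where S: "discrete_set S" "S \<noteq> {}" "He S = 4" "6 \<le> Tv S 2"
      using ex_He_4_Tv_2_ge_6 by blast
    have "Tv S 2 \<le> He S + 2" using main[OF S(2)] S(3) by simp
    then have "Tv S 2 = He S + 2" using S(3,4) by (simp add: numeral_eq_enat)
    then show ?thesis using S by (intro exI[of _ S]) auto
  qed
  ultimately show ?thesis by blast
qed

end
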